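(* Let $d\ge1$ and let $\mathbf{h}'$, $\mathbf{h}''$ be $d$-dimensional probability vectors with $\mathbf{h}'\succ\mathbf{h}''$. Then: (a) $\mathbb{P}(T^{\mathbf{h}'}<\infty)\ge\mathbb{P}(T^{\mathbf{h}''}<\infty)$. (b) If $\mathbf{h}''$ has fewer than $3$ non-zero entries, then $\mathbb{P}(T^{\mathbf{h}'}<\infty)=\mathbb{P}(T^{\mathbf{h}''}<\infty)=1$. (c) If $\mathbf{h}''$ has three or more non-zero entries, then $R^{\mathbf{h}''}<\infty$, $R^{\mathbf{h}'}>R^{\mathbf{h}''}$, and $\mathbb{P}(T^{\mathbf{h}'}<\infty)>\mathbb{P}(T^{\mathbf{h}''}<\infty)$. (d) $\mathbb{P}(T^{\mathbf{h}'}\le2)>\mathbb{P}(T^{\mathbf{h}''}\le2)$, and hence $T^{\mathbf{h}'}$ is strictly stochastically smaller than $T^{\mathbf{h}''}$. In particular, $\mathbb{P}(\tau_d<\infty)$ is strictly decreasing in $d\ge3$, and $\tau_d$ is strictly stochastically increasing in $d\ge1$ (that is, $\tau_d$ is strictly stochastically smaller than $\tau_{d+1}$ for every $d\ge 1$).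
   Context: A vector $\mathbf{h}=(h_1,\dots,h_d)\in\mathbb{R}^d$ is a probability vector if $h_i\ge 0$ for all $i$ and $h_1+\cdots+h_d=1$. For two vectors $\mathbf{h}'=(h'_1,\dots,h'_d)$ and $\mathbf{h}''=(h''_1,\dots,h''_d)$, $\mathbf{h}'$ majorizes $\mathbf{h}''$ (written $\mathbf{h}'\succeq\mathbf{h}''$) if $\sum_{i=1}^j h'_{(i)}\ge\sum_{i=1}^j h''_{(i)}$ for $j=1,\dots,d-1$ and $\sum_{i=1}^d h'_{(i)}=\sum_{i=1}^d h''_{(i)}$, where $(h'_{(1)},\dots,h'_{(d)})$ is the permutation of $\mathbf{h}'$ in decreasing order, and similarly for $\mathbf{h}''$. $\mathbf{h}'$ strictly majorizes $\mathbf{h}''$ (written $\mathbf{h}'\succ\mathbf{h}''$) if $\mathbf{h}'\succeq\mathbf{h}''$ and $\mathbf{h}'$ is not a permutation of $\mathbf{h}''$. Let $\mathbf{0}_d$ be the zero vector and $\mathbf{e}_d^i$ the $i$-th standard unit vector of $\mathbb{Z}^d$. For a probability vector $\mathbf{h}=(h_1,\dots,h_d)$, $(S^{\mathbf{h}}_n)_{n\ge 0}$ is the random walk on $\mathbb{Z}^d$ with $S^{\mathbf{h}}_0=\mathbf{0}_d$ and $S^{\mathbf{h}}_n=X^{\mathbf{h}}_1+\cdots+X^{\mathbf{h}}_n$ for $n\ge1$, where the increments $X^{\mathbf{h}}_n$ are i.i.d. with $\mathbb{P}(X^{\mathbf{h}}_n=\mathbf{e}_d^i)=\mathbb{P}(X^{\mathbf{h}}_n=-\mathbf{e}_d^i)=\frac12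 h_i$ for $i=1,\dots,d$. The first return time is $T^{\mathbf{h}}=\inf\{n\geq 1: S^{\mathbf{h}}_n=\mathbf{0}_d\}$ (with $\inf\emptyset=\infty$), and $R^{\mathbf{h}}=\sum_{n=1}^\infty\mathbb{P}(S^{\mathbf{h}}_{2n}=\mathbf{0}_d)\in[0,\infty]$ is the expected total number of returns to $\mathbf{0}_d$. $\tau_d$ denotes the first return time of the $d$-dimensional simple random walk, i.e. $\tau_d=T^{\mathbf{h}}$ for $\mathbf{h}=(\frac1d,\dots,\frac1d)$ ($d$ entries). For random times $T,T'$ with values in $\{1,2,\dots\}\cup\{\infty\}$, $T$ is stochastically smaller than $T'$ if $\mathbb{P}(T\le n)\ge\mathbb{P}(T'\le n)$ for all $n\ge1$, and strictly stochastically smaller if moreover the inequality is strict for some $n$. *)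

theory Defs
  imports "HOL-Probability.Probability" "HOL-Library.Multiset" "HOL-Library.Extended_Nat"
begin

text \<open>Vectors of \<open>\<real>\<^sup>d\<close> are lists of length \<open>d\<close>; coordinates are numbered \<open>0, \<dots>, d - 1\<close>.\<close>

definition prob_vector :: "nat \<Rightarrow> real list \<Rightarrow> bool" where
  "prob_vector d h \<longleftrightarrow> length h = d \<and> (\<forall>i<d. 0 \<le> h ! i) \<and> (\<Sum>i<d. h ! i) = 1"

definition decreasing :: "real list \<Rightarrow> real list" where
  "decreasing h = rev (sort h)"

definition majorizes :: "real list \<Rightarrow> real list \<Rightarrow> bool" where
  "majorizes h' h'' \<longleftrightarrow> length h' = length h'' \<and>
     (\<forall>j\<in>{1..<length h'}. (\<Sum>i<j. decreasing h' ! i) \<ge> (\<Sum>i<j. decreasing h'' ! i)) \<and>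
     (\<Sum>i<length h'. decreasing h' ! i) = (\<Sum>i<length h''. decreasing h'' ! i)"

text \<open>Two lists are permutations of each other iff they have the same underlying multiset.\<close>

definition strictly_majorizes :: "real list \<Rightarrow> real list \<Rightarrow> bool" where
  "strictly_majorizes h' h'' \<longleftrightarrow> majorizes h' h'' \<and> mset h' \<noteq> mset h''"

definition num_nonzero :: "real list \<Rightarrow> nat" where
  "num_nonzero h = card {i. i < length h \<and> h ! i \<noteq> 0}"

text \<open>\<open>\<int>\<^sup>d\<close> consists of the integer sequences that vanish from index \<open>d\<close> on.\<close>

definition lattice_Z :: "nat \<Rightarrow> (nat \<Rightarrow> int) set" where
  "lattice_Z d = {v. \<forall>i\<ge>d. v i = 0}"

definition zero_vector :: "nat \<Rightarrow> int" where
  "zero_vector = (\<lambda>j. 0)"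

definition std_unit :: "nat \<Rightarrow> nat \<Rightarrow> int" where
  "std_unit i = (\<lambda>j. if j = i then 1 else 0)"

text \<open>
  The increments are \<open>X 1, X 2, \<dots>\<close>; the value \<open>X 0\<close> is irrelevant. That they are identically
  distributed is part of \<open>step_pos\<close> and \<open>step_neg\<close>, whose probabilities
  add up to 1 when \<open>h\<close> is a probability vector.
\<close>

locale random_walk = prob_space M
  for d :: nat and h :: "real list" and M :: "'a measure" and X :: "nat \<Rightarrow> 'a \<Rightarrow> nat \<Rightarrow> int" +
  assumes indep: "indep_vars (\<lambda>_. count_space (lattice_Z d)) X {1..}"
    and step_pos: "\<And>n i. 1 \<le> n \<Longrightarrow> i < d \<Longrightarrow> \<P>(\<omega> in M. X n \<omega> = std_unit i) = h ! i / 2"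
    and step_neg: "\<And>n i. 1 \<le> n \<Longrightarrow> i < d \<Longrightarrow> \<P>(\<omega> in M. X n \<omega> = - std_unit i) = h ! i / 2"

definition walk :: "(nat \<Rightarrow> 'a \<Rightarrow> nat \<Rightarrow> int) \<Rightarrow> nat \<Rightarrow> 'a \<Rightarrow> nat \<Rightarrow> int" where
  "walk X n \<omega> = (\<lambda>j. \<Sum>k=1..n. X k \<omega> j)"

definition return_time :: "(nat \<Rightarrow> 'a \<Rightarrow> nat \<Rightarrow> int) \<Rightarrow> 'a \<Rightarrow> enat" where
  "return_time X \<omega> = Inf {enat n | n. 1 \<le> n \<and> walk X n \<omega> = zero_vector}"

definition expected_returns :: "'a measure \<Rightarrow> (nat \<Rightarrow> 'a \<Rightarrow> nat \<Rightarrow> int) \<Rightarrow> ennreal" where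
  "expected_returns M X =
     (\<Sum>n. ennreal (\<P>(\<omega> in M. walk X (2 * Suc n) \<omega> = zero_vector)))"

definition uniform_vector :: "nat \<Rightarrow> real list" where
  "uniform_vector d = replicate d (1 / real d)"

definition stoch_smaller :: "'a measure \<Rightarrow> ('a \<Rightarrow> enat) \<Rightarrow> 'b measure \<Rightarrow> ('b \<Rightarrow> enat) \<Rightarrow> bool" where
  "stoch_smaller M T N T' \<longleftrightarrow>
     (\<forall>n\<ge>1. \<P>(\<omega> in M. T \<omega> \<le> enat n) \<ge> \<P>(\<omega> in N. T' \<omega> \<le> enat n))"

definition strictly_stoch_smaller ::
    "'a measure \<Rightarrow> ('a \<Rightarrow> enat) \<Rightarrow> 'b measure \<Rightarrow> ('b \<Rightarrow> enat) \<Rightarrow> bool" where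
  "strictly_stoch_smaller M T N T' \<longleftrightarrow> stoch_smaller M T N T' \<and>
     (\<exists>n\<ge>1. \<P>(\<omega> in M. T \<omega> \<le> enat n) > \<P>(\<omega> in N. T' \<omega> \<le> enat n))"

text \<open>The walk exists for every probability vector: take i.i.d. pairs of an axis and a sign.\<close>

lemma ex_random_walk:
  assumes h: "prob_vector d h"
  shows "\<exists>(M :: (nat \<Rightarrow> nat \<times> bool) measure) X. random_walk d h M X"
proof -
  define f where "f = (\<lambda>i. if i < d then h ! i else 0)"
  define p where "p = pair_pmf (embed_pmf f) (bernoulli_pmf (1/2))"
  define g :: "nat \<times> bool \<Rightarrow> nat \<Rightarrow> int" where
    "g = (\<lambda>(i, b). if i < d then if b then std_unit i else - std_unit i else zero_vector)"
  define M where "M = PiM (UNIV :: nat set) (\<lambda>_. measure_pmf p)"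
  define X where "X = (\<lambda>n (\<omega> :: nat \<Rightarrow> nat \<times> bool). g (\<omega> n))"
  have nonneg: "0 \<le> f i" for i using h by (auto simp: f_def prob_vector_def)
  have "(\<integral>\<^sup>+i. ennreal (f i) \<partial>count_space UNIV) = (\<Sum>i<d. ennreal (f i))"
    by (rule nn_integral_count_space'[where A = "{..<d}"]) (auto simp: f_def)
  also have "\<dots> = 1"
    using h nonneg by (subst sum_ennreal) (auto simp: f_def prob_vector_def)
  finally have pf: "pmf (embed_pmf f) i = f i" for i
    by (intro pmf_embed_pmf nonneg)
  interpret P: product_prob_space "\<lambda>_::nat. measure_pmf p" UNIV
    by unfold_locales
  interpret M: prob_space M
    unfolding M_def by (rule P.prob_space_axioms)
  have coord: "distr M (measure_pmf p) (\<lambda>\<omega>. \<omega> n) = measure_pmf p" for n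
    unfolding M_def by (rule P.PiM_component) simp
  have meas: "(\<lambda>\<omega>. \<omega> n) \<in> measurable M (measure_pmf p)" for n
    unfolding M_def by (rule measurable_component_singleton) simp
  have "M.indep_vars (\<lambda>_. measure_pmf p) (\<lambda>n \<omega>. \<omega> n) UNIV"
  proof (subst M.indep_vars_iff_distr_eq_PiM)
    have "distr M (PiM UNIV (\<lambda>_. measure_pmf p)) (\<lambda>x. \<lambda>i\<in>UNIV. x i) = M"
      by (simp add: M_def restrict_def distr_id2)
    then show "distr M (PiM UNIV (\<lambda>_. measure_pmf p)) (\<lambda>x. \<lambda>i\<in>UNIV. x i) =
        (\<Pi>\<^sub>M i\<in>UNIV. distr M (measure_pmf p) (\<lambda>\<omega>. \<omega> i))"
      unfolding coord by (simp add: M_def)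
  qed (use meas in auto)
  then have "M.indep_vars (\<lambda>_. measure_pmf p) (\<lambda>n \<omega>. \<omega> n) {1..}"
    by (rule M.indep_vars_subset) auto
  then have indep: "M.indep_vars (\<lambda>_. count_space (lattice_Z d)) X {1..}"
    unfolding X_def
    by (rule M.indep_vars_compose2)
      (auto simp: g_def lattice_Z_def std_unit_def zero_vector_def split: prod.splits)
  have law: "\<P>(\<omega> in M. X n \<omega> = v) = measure p {y. g y = v}" for n v
  proof -
    have "measure p {y. g y = v} = measure (distr M (measure_pmf p) (\<lambda>\<omega>. \<omega> n)) {y. g y = v}"
      by (simp only: coord)
    also have "\<dots> = \<P>(\<omega> in M. X n \<omega> = v)"
      by (subst measure_distr[OF meas]) (auto simp: X_def intro!: arg_cong[where f = "measure M"])
    finally show ?thesis by simp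
  qed
  have unit: "std_unit i = std_unit j \<longleftrightarrow> i = j" "std_unit i \<noteq> - std_unit j"
    "std_unit i \<noteq> zero_vector" for i j
  proof -
    have 1: "std_unit i i = 1" for i by (simp add: std_unit_def)
    show "std_unit i = std_unit j \<longleftrightarrow> i = j"
      by (metis 1 std_unit_def zero_neq_one)
    show "std_unit i \<noteq> - std_unit j"
    proof
      assume "std_unit i = - std_unit j"
      then have "std_unit i i = - std_unit j i" by (metis uminus_apply)
      then show False by (simp add: std_unit_def split: if_splits)
    qed
    show "std_unit i \<noteq> zero_vector"
      by (metis 1 zero_vector_def zero_neq_one)
  qed
  have unit': "- std_unit i = - std_unit j \<longleftrightarrow> i = j" "- std_unit i \<noteq> zero_vector"
    "- std_unit i \<noteq> std_unit j" for i j
  proof -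
    have neg: "- (- v) = v" for v :: "nat \<Rightarrow> int" by (simp add: fun_eq_iff)
    have neg0: "- zero_vector = zero_vector" by (simp add: fun_eq_iff zero_vector_def)
    show "- std_unit i = - std_unit j \<longleftrightarrow> i = j" by (metis neg unit(1))
    show "- std_unit i \<noteq> zero_vector" by (metis neg neg0 unit(3))
    show "- std_unit i \<noteq> std_unit j" using unit(2)[of j i] by metis
  qed
  have "{y. g y = std_unit i} = {(i, True)}" "{y. g y = - std_unit i} = {(i, False)}"
    if "i < d" for i
    using that
    by (auto simp: g_def unit unit' unit(3)[symmetric] unit'(2)[symmetric] split: if_splits)
  then have "\<P>(\<omega> in M. X n \<omega> = std_unit i) = h ! i / 2"
    "\<P>(\<omega> in M. X n \<omega> = - std_unit i) = h ! i / 2" if "i < d" for n i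
    unfolding law using that
    by (simp_all add: measure_pmf_single p_def pmf_pair pf) (simp_all add: f_def)
  then have "random_walk d h M X"
    by (intro random_walk.intro M.prob_space_axioms random_walk_axioms.intro indep) auto
  then show ?thesis by blast
qed

end

theory Submission
  imports Defs
begin

text \<open>
  Write \<open>u n\<close> for the probability that the walk is at the origin at time \<open>2 n\<close> and \<open>g n\<close> for the
  probability that it has not returned by time \<open>2 n\<close>. Splitting at the last visit to the origin
  gives \<open>(\<Sum>k\<le>n. u k * g (n - k)) = 1\<close>; in terms of generating functions
  \<open>U(z) G(z) = 1 / (1 - z)\<close>.

  A closed path of length \<open>2 n\<close> has \<open>n\<close> positive and \<open>n\<close> negative steps, and the positive ones
  use each axis as often as the negative ones. Hence \<open>u n = a n * b n\<close> with
  \<open>a n = (2 n choose n) / 4 ^ n\<close> and \<open>b n\<close> the probability that two independent samples of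
  size \<open>n\<close> from \<open>h\<close> have the same type, that is, hit each axis equally often.

  \<^item> Each \<open>u n\<close> is Schur convex (\<open>return_prob_majorize\<close>). A majorization is a chain of transfers
    between two coordinates (\<open>robin_hood_chain\<close>), and for two coordinates \<open>x\<close>, \<open>y\<close> the collision
    probability is, up to the scale factor \<open>(x + y) ^ (2 n)\<close>, the Bernstein polynomial of
    the decreasing sequence \<open>a\<close> at \<open>4 x y / (x + y)^2\<close> (\<open>collision_pair\<close>).

  \<^item> For general renewal sequences, larger \<open>u n\<close> would not imply smaller \<open>g n\<close>. Here, however, \<open>b\<close>
    is decreasing (\<open>contracts_type_series\<close>: drawing one more sample is an average of shifts, which
    does not increase a square sum). Therefore the quotient \<open>W = A / U\<close>, where
    \<open>A(z) = (\<Sum>n. a n z^n)\<close>, has nonnegative coefficients (\<open>renewal_quotient_nonneg\<close>). Since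
    \<open>A(z)^2 = 1 / (1 - z)\<close>, two walks satisfy
    \<open>G2 - G1 = A^2 / U2 - A^2 / U1 = W1 * W2 * (U1 - U2)\<close>, and \<open>U1 \<ge> U2\<close> coefficientwise
    gives \<open>G1 \<le> G2\<close> coefficientwise (\<open>renewal_mono\<close>). This is the stochastic order.

  \<^item> The limit of \<open>g\<close> is the reciprocal of \<open>(\<Sum>n. u n)\<close>. With at most two active axes
    \<open>u n \<ge> (a n)^2 \<ge> 1 / (4 n)\<close>, so the walk is recurrent; with three or more,
    \<open>u n = O(n powr (-3/2))\<close>, so it is transient (\<open>not_summable_return_prob\<close>,
    \<open>summable_return_prob\<close>).

  Strictness comes from \<open>u 1\<close>, which is half the sum of the squares of \<open>h\<close>. The uniform vectors are
  compared by padding the shorter one with zeros.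
\<close>

section \<open>Central binomial probabilities\<close>

definition central :: "nat \<Rightarrow> real" where
  "central n = real ((2 * n) choose n) / 4 ^ n"

lemma central_0 [simp]: "central 0 = 1"
  by (simp add: central_def)

lemma central_pos: "0 < central n"
  by (simp add: central_def)

lemma central_fact: "central n = fact (2 * n) / (4 ^ n * fact n ^ 2)"
  by (simp add: central_def binomial_fact power2_eq_square)

lemma central_Suc: "central (Suc n) = central n * ((2 * real n + 1) / (2 * real n + 2))"
proof -
  have "fact (2 * Suc n) = (2 * real n + 2) * (2 * real n + 1) * fact (2 * n)"
    by (simp add: algebra_simps)
  then show ?thesis
    unfolding central_fact
    by (simp only: fact_Suc) (simp add: divide_simps power2_eq_square, simp add: algebra_simps)
qed

lemma central_decseq: "decseq central"
  by (rule decseq_SucI, subst central_Suc) (use central_pos in \<open>auto simp: field_simps\<close>)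

lemma central_lower: "1 \<le> n \<Longrightarrow> 1 / (4 * real n) \<le> central n ^ 2"
proof (induction n rule: dec_induct)
  case base
  then show ?case by (simp add: central_def power2_eq_square)
next
  case (step n)
  have "1 / (4 * real (Suc n)) \<le> 1 / (4 * real n) * ((2 * real n + 1) / (2 * real n + 2)) ^ 2"
    using step by (simp add: divide_simps power2_eq_square) (simp add: algebra_simps)
  also have "\<dots> \<le> central n ^ 2 * ((2 * real n + 1) / (2 * real n + 2)) ^ 2"
    by (intro mult_right_mono step.IH) auto
  also have "\<dots> = central (Suc n) ^ 2"
    by (simp only: central_Suc power_mult_distrib)
  finally show ?case .
qed

lemma central_upper: "central n \<le> 1 / sqrt (real n + 1)"
proof -
  have "central n ^ 2 \<le> 1 / (2 * real n + 1)"
  proof (induction n)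
    case (Suc n)
    have "central (Suc n) ^ 2 = central n ^ 2 * ((2 * real n + 1) / (2 * real n + 2)) ^ 2"
      by (simp only: central_Suc power_mult_distrib)
    also have "\<dots> \<le> 1 / (2 * real n + 1) * ((2 * real n + 1) / (2 * real n + 2)) ^ 2"
      by (intro mult_right_mono Suc) auto
    also have "\<dots> \<le> 1 / (2 * real (Suc n) + 1)"
      by (simp add: divide_simps power2_eq_square) (simp add: algebra_simps)
    finally show ?case .
  qed simp
  also have "\<dots> \<le> 1 / (real n + 1)"
    by (simp add: field_simps)
  finally have "sqrt (central n ^ 2) \<le> sqrt (1 / (real n + 1))"
    by (rule real_sqrt_le_mono)
  then show ?thesis
    using central_pos[of n] by (simp add: real_sqrt_divide)
qed

text \<open>
  The generating function is \<open>(1 - z) powr (-1/2)\<close>. It is pinned down by the differential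
  equation \<open>2 (1 - z) A' = A\<close>, which makes \<open>(1 - z) A^2\<close> constant.
\<close>

lemma central_square: "Abs_fps central ^ 2 = Abs_fps (\<lambda>_. 1)"
proof -
  define A where "A = Abs_fps central"
  have ode: "2 * ((1 - fps_X) * fps_deriv A) = A"
  proof (rule fps_ext)
    fix n
    have "fps_nth (2 * ((1 - fps_X) * fps_deriv A)) n
        = 2 * (fps_nth (fps_deriv A) n - (if n = 0 then 0 else fps_nth (fps_deriv A) (n - 1)))"
      by (simp add: left_diff_distrib numeral_fps_const)
    also have "\<dots> = fps_nth A n"
      
    proof (cases n)
      case (Suc m)
      have "(2 * real n + 2) * central (Suc n) = (2 * real n + 1) * central n"
        by (simp add: central_Suc)
      then show ?thesis
        by (simp add: A_def Suc algebra_simps)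
    qed (simp add: A_def central_Suc)
    finally show "fps_nth (2 * ((1 - fps_X) * fps_deriv A)) n = fps_nth A n" .
  qed
  have "fps_deriv ((1 - fps_X) * A ^ 2) = A * (2 * ((1 - fps_X) * fps_deriv A) - A)"
    by (simp add: power2_eq_square algebra_simps)
  then have "fps_deriv ((1 - fps_X) * A ^ 2) = 0"
    by (simp add: ode)
  then have "(1 - fps_X) * A ^ 2 = fps_const (fps_nth ((1 - fps_X) * A ^ 2) 0)"
    by (simp only: fps_deriv_eq_0_iff)
  also have "\<dots> = 1"
    by (simp add: A_def power2_eq_square)
  finally have "(1 - fps_X) * A ^ 2 = 1" .
  moreover have "(1 - fps_X) * Abs_fps (\<lambda>_. 1 :: real) = 1"
    by (rule fps_ext) (simp add: left_diff_distrib)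
  ultimately have "A ^ 2 = (1 - fps_X) * Abs_fps (\<lambda>_. 1) * A ^ 2" "(1 - fps_X) * A ^ 2 = 1"
    by simp_all
  then show ?thesis
    by (simp only: A_def mult_ac) simp
qed

section \<open>Bernstein sums\<close>

text \<open>
  Homogeneous in \<open>(p, q)\<close>: for \<open>p + q = 1\<close> it is the expectation of \<open>f\<close> under the
  binomial distribution with parameters \<open>n\<close> and \<open>p\<close>.
\<close>

definition bernstein :: "nat \<Rightarrow> (nat \<Rightarrow> real) \<Rightarrow> real \<Rightarrow> real \<Rightarrow> real" where
  "bernstein n f p q = (\<Sum>k\<le>n. real (n choose k) * p ^ k * q ^ (n - k) * f k)"

lemma bernstein_0 [simp]: "bernstein 0 f p q = f 0"
  by (simp add: bernstein_def)

lemma bernstein_Suc: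
  "bernstein (Suc n) f p q = q * bernstein n f p q + p * bernstein n (\<lambda>k. f (Suc k)) p q"
proof -
  define g where "g k = real (n choose k) * p ^ k * q ^ (Suc n - k) * f k" for k
  have "bernstein (Suc n) f p q = q ^ Suc n * f 0
      + (\<Sum>k\<le>n. real (Suc n choose Suc k) * p ^ Suc k * q ^ (n - k) * f (Suc k))"
    unfolding bernstein_def by (subst sum.atMost_Suc_shift) simp
  also have "(\<Sum>k\<le>n. real (Suc n choose Suc k) * p ^ Suc k * q ^ (n - k) * f (Suc k))
      = p * bernstein n (\<lambda>k. f (Suc k)) p q + (\<Sum>k\<le>n. g (Suc k))"
    unfolding bernstein_def g_def sum_distrib_left sum.distrib[symmetric]
    by (intro sum.cong refl) (simp add: algebra_simps)
  also have "q ^ Suc n * f 0 = g 0"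
    by (simp add: g_def)
  also have "g 0 + (p * bernstein n (\<lambda>k. f (Suc k)) p q + (\<Sum>k\<le>n. g (Suc k)))
      = p * bernstein n (\<lambda>k. f (Suc k)) p q + (\<Sum>k\<le>Suc n. g k)"
    by (subst sum.atMost_Suc_shift[where g = g]) simp
  also have "(\<Sum>k\<le>Suc n. g k) = (\<Sum>k\<le>n. g k)"
    by (simp add: g_def)
  also have "\<dots> = q * bernstein n f p q"
    unfolding bernstein_def g_def sum_distrib_left
    by (intro sum.cong refl) (simp add: Suc_diff_le algebra_simps)
  finally show ?thesis by simp
qed

lemma bernstein_const: "bernstein n (\<lambda>_. c) p q = c * (p + q) ^ n"
  by (induction n) (auto simp: bernstein_Suc algebra_simps)

lemma bernstein_mono:
  assumes "0 \<le> p" "0 \<le> q" "\<And>k. k \<le> n \<Longrightarrow> f k \<le> g k"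
  shows "bernstein n f p q \<le> bernstein n g p q"
  unfolding bernstein_def using assms by (intro sum_mono mult_left_mono) auto

text \<open>
  More successes mean smaller values of a decreasing \<open>f\<close>. Conditioning on the first trial
  reduces \<open>n + 1\<close> trials to \<open>n\<close>.
\<close>

lemma bernstein_antimono:
  assumes "decseq f" "0 \<le> p" "p \<le> p'" "0 \<le> q'" "p + q = p' + q'"
  shows "bernstein n f p' q' \<le> bernstein n f p q"
  using assms(1)
proof (induction n arbitrary: f)
  case (Suc n)
  have dec: "decseq (\<lambda>k. f (Suc k))"
    using Suc.prems by (auto simp: decseq_def)
  have q: "0 \<le> q" "0 \<le> p'" using assms by auto
  have "bernstein (Suc n) f p' q' = q' * bernstein n f p' q' + p' * bernstein n (\<lambda>k. f (Suc k)) p' q'"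
    by (rule bernstein_Suc)
  also have "\<dots> \<le> q' * bernstein n f p q + p' * bernstein n (\<lambda>k. f (Suc k)) p q"
    using Suc.IH[OF Suc.prems] Suc.IH[OF dec] assms q by (intro add_mono mult_left_mono) auto
  also have "\<dots> = q' * bernstein n f p q + (p + (q - q')) * bernstein n (\<lambda>k. f (Suc k)) p q"
    using assms by simp
  also have "\<dots> \<le> q' * bernstein n f p q + p * bernstein n (\<lambda>k. f (Suc k)) p q
      + (q - q') * bernstein n f p q"
  proof -
    have "bernstein n (\<lambda>k. f (Suc k)) p q \<le> bernstein n f p q"
      using assms q decseqD[OF Suc.prems] by (intro bernstein_mono) auto
    then have "(q - q') * bernstein n (\<lambda>k. f (Suc k)) p q \<le> (q - q') * bernstein n f p q"
      using assms by (intro mult_left_mono) auto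
    then show ?thesis by (simp add: algebra_simps)
  qed
  also have "\<dots> = bernstein (Suc n) f p q"
    by (simp add: bernstein_Suc algebra_simps)
  finally show ?case .
qed simp

text \<open>
  Multiplying by \<open>(n + 1) * p\<close> turns the terms into those of the binomial expansion with exponent
  \<open>n + 1\<close>, without its term for \<open>k = 0\<close>.
\<close>

lemma bernstein_reciprocal_le:
  assumes "0 < p" "0 \<le> q"
  shows "bernstein n (\<lambda>k. 1 / (real k + 1)) p q \<le> (p + q) ^ Suc n / (p * (real n + 1))"
proof -
  have "p * (real n + 1) * bernstein n (\<lambda>k. 1 / (real k + 1)) p q
      = (\<Sum>k\<le>n. real (Suc n choose Suc k) * p ^ Suc k * q ^ (Suc n - Suc k))"
    unfolding bernstein_def sum_distrib_left
  proof (intro sum.cong refl)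
    fix k
    have "real (Suc k) * real (Suc n choose Suc k) = real (Suc n) * real (n choose k)"
      using Suc_times_binomial_eq[of n k] by (metis of_nat_mult mult.commute)
    then have "(real n + 1) * real (n choose k) * (1 / (real k + 1)) = real (Suc n choose Suc k)"
      by (simp add: divide_simps add.commute mult.commute del: binomial_Suc_Suc)
    moreover have "p * (real n + 1) * (real (n choose k) * p ^ k * q ^ (n - k) * (1 / (real k + 1)))
        = (real n + 1) * real (n choose k) * (1 / (real k + 1)) * p ^ Suc k * q ^ (n - k)"
      by simp
    ultimately show "p * (real n + 1) * (real (n choose k) * p ^ k * q ^ (n - k) * (1 / (real k + 1)))
        = real (Suc n choose Suc k) * p ^ Suc k * q ^ (Suc n - Suc k)"
      by (metis diff_Suc_Suc)
  qed
  also have "\<dots> \<le> (\<Sum>k\<le>Suc n. real (Suc n choose k) * p ^ k * q ^ (Suc n - k))"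
    using assms by (simp add: sum.atMost_Suc_shift del: binomial_Suc_Suc sum.atMost_Suc)
  also have "\<dots> = (p + q) ^ Suc n"
    by (simp only: binomial_ring)
  finally have "p * (real n + 1) * bernstein n (\<lambda>k. 1 / (real k + 1)) p q \<le> (p + q) ^ Suc n" .
  moreover have "0 < p * (real n + 1)"
    using assms by (intro mult_pos_pos) auto
  ultimately show ?thesis
    by (subst pos_le_divide_eq) (simp_all only: mult.commute)
qed

section \<open>Collision probabilities of types\<close>

definition square_exp :: "real \<Rightarrow> real fps" where
  "square_exp x = Abs_fps (\<lambda>k. (x ^ k / fact k) ^ 2)"

text \<open>
  For \<open>F\<close> the product of the series \<open>square_exp (h i)\<close>, this is the sum of the squares of the
  multinomial probabilities with parameters \<open>n\<close> and \<open>h\<close>, that is, the probability that two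
  independent samples have the same type. The series \<open>square_exp\<close> make products of axes
  into products of power series.
\<close>

definition collision :: "real fps \<Rightarrow> nat \<Rightarrow> real" where
  "collision F n = fact n ^ 2 * fps_nth F n"

lemma square_exp_nonneg: "0 \<le> fps_nth (square_exp x) n"
  by (simp add: square_exp_def)

lemma square_exp_nth_0 [simp]: "fps_nth (square_exp x) 0 = 1"
  by (simp add: square_exp_def)

lemma square_exp_0 [simp]: "square_exp 0 = 1"
  by (rule fps_ext) (simp add: square_exp_def)

lemma collision_square_exp: "collision (square_exp x) n = (x ^ n) ^ 2"
  by (simp add: collision_def square_exp_def power_divide)

lemma collision_mult:
  "collision (F * G) n = (\<Sum>k\<le>n. real (n choose k) ^ 2 * collision F k * collision G (n - k))"
  unfolding collision_def fps_mult_nth sum_distrib_left atMost_atLeast0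
  by (intro sum.cong refl) (simp add: binomial_fact power_divide power_mult_distrib)

text \<open>
  Both sides are the coefficient of \<open>t ^ n\<close> in \<open>((x + y t) (y + x t)) ^ n\<close>: on the left the two
  factors are expanded separately, on the right the product is written as
  \<open>x y (1 + t)^2 + (x - y)^2 t\<close>.
\<close>

lemma collision_pair: "collision (square_exp x * square_exp y) n = bernstein n central (4 * x * y) ((x - y) ^ 2)"
proof -
  define P where "P = [:x, y:] ^ n * [:y, x:] ^ n"
  have "collision (square_exp x * square_exp y) n
      = (\<Sum>k\<le>n. real (n choose k) ^ 2 * (x ^ k) ^ 2 * (y ^ (n - k)) ^ 2)"
    by (simp add: collision_mult collision_square_exp)
  also have "\<dots> = (\<Sum>k\<le>n. coeff ([:y, x:] ^ n) k * coeff ([:x, y:] ^ n) (n - k))"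
    by (intro sum.cong refl)
      (simp add: coeff_linear_poly_power binomial_symmetric[symmetric] power2_eq_square algebra_simps)
  also have "\<dots> = coeff P n"
    by (simp add: P_def coeff_mult mult.commute[of "[:x, y:] ^ n"])
  also have "P = ([:x * y:] * [:1, 1:] ^ 2 + monom ((x - y) ^ 2) 1) ^ n"
  proof -
    have "[:x, y:] * [:y, x:] = [:x * y:] * [:1, 1:] ^ 2 + monom ((x - y) ^ 2) 1"
      by (simp add: power2_eq_square monom_altdef algebra_simps)
    then show ?thesis
      by (simp only: P_def power_mult_distrib[symmetric])
  qed
  also have "\<dots> = (\<Sum>k\<le>n. smult (real (n choose k) * (x * y) ^ k)
      (monom (((x - y) ^ 2) ^ (n - k)) (n - k) * [:1, 1:] ^ (2 * k)))"
    unfolding binomial_ring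
    by (intro sum.cong refl)
      (simp add: power_mult_distrib smult_power poly_const_pow of_nat_poly monom_power power_mult[symmetric] mult_ac)
  also have "coeff \<dots> n = (\<Sum>k\<le>n. real (n choose k) * (x * y) ^ k * (((x - y) ^ 2) ^ (n - k)
      * real ((2 * k) choose k)))"
    unfolding coeff_sum
  proof (intro sum.cong refl)
    fix k assume "k \<in> {..n}"
    then have "n - (n - k) = k" "(n < n - k) = False" by auto
    then show "coeff (smult (real (n choose k) * (x * y) ^ k)
        (monom (((x - y) ^ 2) ^ (n - k)) (n - k) * [:1, 1:] ^ (2 * k))) n
      = real (n choose k) * (x * y) ^ k * (((x - y) ^ 2) ^ (n - k) * real ((2 * k) choose k))"
      by (simp add: coeff_monom_mult coeff_linear_poly_power)
  qed
  also have "\<dots> = bernstein n central (4 * x * y) ((x - y) ^ 2)"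
    unfolding bernstein_def central_def
    by (intro sum.cong refl) (simp add: power_mult_distrib)
  finally show ?thesis .
qed

text \<open>
  A transfer that brings \<open>x\<close> and \<open>y\<close> closer keeps \<open>4 x y + (x - y)^2 = (x + y)^2\<close> and increases
  \<open>4 x y\<close>.
\<close>

lemma collision_pair_antimono:
  assumes "0 \<le> e" "0 \<le> y" "y + e \<le> x - e"
  shows "collision (square_exp (x - e) * square_exp (y + e)) n \<le> collision (square_exp x * square_exp y) n"
  unfolding collision_pair
proof (rule bernstein_antimono[OF central_decseq])
  have "0 \<le> e * (x - y - e)"
    using assms by (intro mult_nonneg_nonneg) auto
  then show "4 * x * y \<le> 4 * (x - e) * (y + e)"
    by (simp add: algebra_simps)
  show "0 \<le> 4 * x * y" using assms by auto
  show "4 * x * y + (x - y) ^ 2 = 4 * (x - e) * (y + e) + (x - e - (y + e)) ^ 2"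
    by (simp add: power2_eq_square algebra_simps)
qed simp

lemma collision_pair_ge:
  assumes "0 \<le> x" "0 \<le> y" "x + y = 1"
  shows "central n \<le> collision (square_exp x * square_exp y) n"
proof -
  have "4 * x * y + (x - y) ^ 2 = (x + y) ^ 2"
    by (simp add: power2_eq_square algebra_simps)
  then have "central n = bernstein n (\<lambda>_. central n) (4 * x * y) ((x - y) ^ 2)"
    using assms by (simp add: bernstein_const)
  also have "\<dots> \<le> bernstein n central (4 * x * y) ((x - y) ^ 2)"
    using assms decseqD[OF central_decseq] by (intro bernstein_mono) auto
  finally show ?thesis by (simp add: collision_pair)
qed

text \<open>
  This form of the inequality of arithmetic and geometric means replaces reciprocal square roots
  by reciprocals, whose binomial averages are explicit.
\<close>

lemma inverse_sqrt_le:
  assumes "0 < a" "0 < b"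
  shows "1 / sqrt a \<le> (sqrt b / a + 1 / sqrt b) / 2"
proof -
  have "0 \<le> (sqrt b / sqrt a - 1) ^ 2 / sqrt b"
    using assms by (intro divide_nonneg_nonneg) auto
  also have "\<dots> = sqrt b / a - 2 / sqrt a + 1 / sqrt b"
    using assms by (simp add: power2_eq_square field_simps)
  finally show ?thesis by simp
qed

lemma collision_pair_le:
  assumes "0 < x" "0 < y"
  obtains C where "0 \<le> C" "\<And>n. collision (square_exp x * square_exp y) n \<le> C * ((x + y) ^ n) ^ 2 / sqrt (real n + 1)"
proof
  define p q where "p = 4 * x * y" and "q = (x - y) ^ 2"
  have p: "0 < p" "0 \<le> q"
    using assms by (auto simp: p_def q_def)
  have pq: "p + q = (x + y) ^ 2"
    by (simp add: p_def q_def power2_eq_square algebra_simps)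
  define C where "C = ((x + y) ^ 2 / p + 1) / 2"
  show "0 \<le> C" using p by (simp add: C_def)
  fix n
  define r where "r = sqrt (real n + 1)"
  have r: "0 < r" "r * r = real n + 1" by (auto simp: r_def)
  have "collision (square_exp x * square_exp y) n = bernstein n central p q"
    by (simp add: collision_pair p_def q_def)
  also have "\<dots> \<le> bernstein n (\<lambda>k. (r / (real k + 1) + 1 / r) / 2) p q"
  proof (rule bernstein_mono[OF less_imp_le[OF p(1)] p(2)])
    fix k
    have "1 / sqrt (real k + 1) \<le> (r / (real k + 1) + 1 / r) / 2"
      unfolding r_def by (rule inverse_sqrt_le) auto
    with central_upper show "central k \<le> (r / (real k + 1) + 1 / r) / 2"
      by (rule order_trans)
  qed
  also have "\<dots> = r / 2 * bernstein n (\<lambda>k. 1 / (real k + 1)) p q + 1 / (2 * r) * bernstein n (\<lambda>_. 1) p q"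
    unfolding bernstein_def sum_distrib_left sum.distrib[symmetric]
    by (intro sum.cong refl) (simp add: distrib_left add_divide_distrib mult_ac)
  also have "\<dots> \<le> r / 2 * ((p + q) ^ Suc n / (p * (real n + 1))) + 1 / (2 * r) * (p + q) ^ n"
    using p r bernstein_reciprocal_le[of p q n]
    by (intro add_mono mult_left_mono) (auto simp: bernstein_const)
  also have "\<dots> = C * (p + q) ^ n / r"
    using r(1) p unfolding C_def pq[symmetric] r(2)[symmetric] by (simp add: field_simps)
  also have "(p + q) ^ n = ((x + y) ^ n) ^ 2"
    by (simp add: pq power_mult[symmetric] mult.commute)
  finally show "collision (square_exp x * square_exp y) n \<le> C * ((x + y) ^ n) ^ 2 / sqrt (real n + 1)"
    by (simp add: r_def)
qed

text \<open>
  Convolution with a measure of mass \<open>s\<close> multiplies the square norm by at most \<open>s^2\<close>. This form of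
  that fact is closed under products of series, so it can be checked one axis at a time.
\<close>

definition contracts :: "real \<Rightarrow> real fps \<Rightarrow> bool" where
  "contracts s F \<longleftrightarrow> 0 \<le> s \<and> (\<forall>n. 0 \<le> fps_nth F n) \<and>
     (\<forall>n. collision F (Suc n) \<le> s ^ 2 * collision F n)"

lemma contracts_square_exp: "0 \<le> x \<Longrightarrow> contracts x (square_exp x)"
  by (auto simp: contracts_def square_exp_nonneg collision_square_exp power_mult_distrib)

lemma contracts_1: "contracts 0 1"
  by (simp add: contracts_def collision_def)

lemma contracts_shift:
  assumes "contracts s F"
  shows "real k ^ 2 * fps_nth F k \<le> s ^ 2 * fps_nth (fps_X * F) k"
proof (cases k)
  case (Suc n)
  have "fact n ^ 2 * (real (Suc n) ^ 2 * fps_nth F (Suc n)) \<le> fact n ^ 2 * (s ^ 2 * fps_nth F n)"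
    using assms by (simp add: contracts_def collision_def power_mult_distrib mult_ac)
  then have "real (Suc n) ^ 2 * fps_nth F (Suc n) \<le> s ^ 2 * fps_nth F n"
    by (subst (asm) mult_le_cancel_left_pos) auto
  then show ?thesis by (simp add: Suc)
qed simp

text \<open>
  In terms of plain coefficients the claim reads
  \<open>(n + 1)^2 (F G) (n + 1) \<le> (x + y)^2 (F G) n\<close>. Expanding \<open>(k + j)^2 = k^2 + 2 k j + j^2\<close> in each term of the
  product, the squares are bounded by assumption and the mixed term by the geometric mean of the
  bounds for the squares.
\<close>

lemma contracts_mult:
  assumes F: "contracts x F" and G: "contracts y G"
  shows "contracts (x + y) (F * G)"
proof -
  have nonneg: "0 \<le> fps_nth F k" "0 \<le> fps_nth G k" "0 \<le> x" "0 \<le> y" for k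
    using F G by (auto simp: contracts_def)
  have XF: "0 \<le> fps_nth (fps_X * F) k" "0 \<le> fps_nth (fps_X * G) k" for k
    using nonneg by (auto simp: fps_X_mult_nth)
  have key: "real (k + j) ^ 2 * (fps_nth F k * fps_nth G j) \<le>
      (x + y) * (x * (fps_nth (fps_X * F) k * fps_nth G j) + y * (fps_nth F k * fps_nth (fps_X * G) j))"
    for k j
  proof -
    define w where "w = fps_nth F k * fps_nth G j"
    define P where "P = fps_nth (fps_X * F) k * fps_nth G j"
    define Q where "Q = fps_nth F k * fps_nth (fps_X * G) j"
    have nn: "0 \<le> w" "0 \<le> P" "0 \<le> Q"
      using nonneg XF by (auto simp: w_def P_def Q_def)
    have 1: "real k ^ 2 * w \<le> x ^ 2 * P"
      using mult_right_mono[OF contracts_shift[OF F, of k] nonneg(2)[of j]]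
      by (simp add: w_def P_def mult_ac)
    have 2: "real j ^ 2 * w \<le> y ^ 2 * Q"
      using mult_left_mono[OF contracts_shift[OF G, of j] nonneg(1)[of k]]
      by (simp add: w_def Q_def mult_ac)
    have "(2 * real k * real j * w) ^ 2 = 4 * ((real k ^ 2 * w) * (real j ^ 2 * w))"
      by (simp add: power2_eq_square mult_ac)
    also have "\<dots> \<le> 4 * ((x ^ 2 * P) * (y ^ 2 * Q))"
      using nn mult_mono[OF 1 2] by simp
    also have "\<dots> = (x * y) ^ 2 * (4 * P * Q)"
      by (simp add: power2_eq_square mult_ac)
    also have "\<dots> \<le> (x * y) ^ 2 * (P + Q) ^ 2"
    proof -
      have "0 \<le> (P - Q) ^ 2" by simp
      then have "4 * P * Q \<le> (P + Q) ^ 2"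
        by (simp add: power2_eq_square algebra_simps)
      then show ?thesis by (intro mult_left_mono) auto
    qed
    finally have "(2 * real k * real j * w) ^ 2 \<le> (x * y * (P + Q)) ^ 2"
      by (simp add: power_mult_distrib)
    then have 3: "2 * real k * real j * w \<le> x * y * (P + Q)"
      by (rule power2_le_imp_le) (use nonneg nn in auto)
    have "real (k + j) ^ 2 * w = real k ^ 2 * w + 2 * real k * real j * w + real j ^ 2 * w"
      by (simp add: power2_eq_square algebra_simps)
    also have "\<dots> \<le> x ^ 2 * P + x * y * (P + Q) + y ^ 2 * Q"
      using 1 2 3 by (intro add_mono)
    also have "\<dots> = (x + y) * (x * P + y * Q)"
      by (simp add: power2_eq_square algebra_simps)
    finally show ?thesis by (simp add: w_def P_def Q_def)
  qed
  have "collision (F * G) (Suc n) \<le> (x + y) ^ 2 * collision (F * G) n" for n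
  proof -
    have "real (Suc n) ^ 2 * fps_nth (F * G) (Suc n)
        = (\<Sum>k=0..Suc n. real (k + (Suc n - k)) ^ 2 * (fps_nth F k * fps_nth G (Suc n - k)))"
      unfolding fps_mult_nth sum_distrib_left by (intro sum.cong refl) auto
    also have "\<dots> \<le> (\<Sum>k=0..Suc n. (x + y) * (x * (fps_nth (fps_X * F) k * fps_nth G (Suc n - k))
        + y * (fps_nth F k * fps_nth (fps_X * G) (Suc n - k))))"
      by (intro sum_mono key)
    also have "\<dots> = (x + y) * (x * fps_nth (fps_X * F * G) (Suc n) + y * fps_nth (F * (fps_X * G)) (Suc n))"
      unfolding fps_mult_nth[of "fps_X * F" G] fps_mult_nth[of F "fps_X * G"] sum_distrib_left
        sum.distrib[symmetric] by simp
    also have "\<dots> = (x + y) ^ 2 * fps_nth (F * G) n"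
    proof -
      have "F * (fps_X * G) = fps_X * (F * G)" "fps_X * F * G = fps_X * (F * G)"
        by (simp_all add: mult_ac)
      then show ?thesis
        by (simp only: fps_X_mult_nth) (simp add: power2_eq_square algebra_simps)
    qed
    finally have "fact n ^ 2 * (real (Suc n) ^ 2 * fps_nth (F * G) (Suc n))
        \<le> fact n ^ 2 * ((x + y) ^ 2 * fps_nth (F * G) n)"
      by (intro mult_left_mono) auto
    then show ?thesis
      by (simp add: collision_def power_mult_distrib mult_ac)
  qed
  moreover have "0 \<le> fps_nth (F * G) n" for n
    unfolding fps_mult_nth by (intro sum_nonneg mult_nonneg_nonneg nonneg)
  ultimately show ?thesis
    using nonneg by (auto simp: contracts_def)
qed

lemma contracts_collision_le:
  assumes "contracts s F"
  shows "collision F n \<le> (s ^ n) ^ 2 * fps_nth F 0"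
proof (induction n)
  case (Suc n)
  have "collision F (Suc n) \<le> s ^ 2 * collision F n"
    using assms by (simp add: contracts_def)
  also have "\<dots> \<le> s ^ 2 * ((s ^ n) ^ 2 * fps_nth F 0)"
    by (intro mult_left_mono Suc) auto
  finally show ?case by (simp add: power_mult_distrib mult_ac)
qed (simp add: collision_def)

text \<open>
  The third block of axes, of mass \<open>s\<close>, is bounded by the value for a single axis of
  that mass. What remains is the average of \<open>1 / sqrt (k + 1)\<close> against the squared
  binomial weights \<open>P n k\<close>. The squares sum to \<open>O(1 / sqrt n)\<close> because they are themselves the
  collision probabilities of two axes, and the weight \<open>1 / sqrt (k + 1)\<close> gains the second
  factor \<open>1 / sqrt n\<close>.
\<close>

lemma collision_triple_le:
  assumes "0 < x" "0 < y" "0 < s" "x + y + s = 1" and G: "contracts s G" "fps_nth G 0 = 1"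
  obtains C where "\<And>n. collision (square_exp x * square_exp y * G) n \<le> C / (real n + 1)"
proof -
  define w where "w = x + y"
  have w: "0 < w" "w + s = 1" using assms by (auto simp: w_def)
  obtain C1 where C1: "0 \<le> C1"
    "\<And>n. collision (square_exp x * square_exp y) n \<le> C1 * (w ^ n) ^ 2 / sqrt (real n + 1)"
    unfolding w_def using collision_pair_le[OF assms(1,2)] by blast
  obtain C2 where C2: "0 \<le> C2"
    "\<And>n. collision (square_exp w * square_exp s) n \<le> C2 * ((w + s) ^ n) ^ 2 / sqrt (real n + 1)"
    using collision_pair_le[OF w(1) assms(3)] by blast
  have nn: "0 \<le> collision G k" for k
    using G(1) by (simp add: contracts_def collision_def)
  have "collision (square_exp x * square_exp y * G) n \<le> (C1 * (C2 / w + C2) / 2) / (real n + 1)" for n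
  proof -
    define r where "r = sqrt (real n + 1)"
    have r: "0 < r" "r * r = real n + 1" by (auto simp: r_def)
    define P where "P n k = real (n choose k) * w ^ k * s ^ (n - k)" for n k
    have sumP: "(\<Sum>k\<le>n. P n k ^ 2) \<le> C2 / sqrt (real n + 1)" for n
    proof -
      have "(\<Sum>k\<le>n. P n k ^ 2) = collision (square_exp w * square_exp s) n"
        by (simp add: P_def collision_mult collision_square_exp power_mult_distrib)
      then show ?thesis using C2(2)[of n] by (simp add: w(2))
    qed
    have "collision (square_exp x * square_exp y * G) n
        = (\<Sum>k\<le>n. real (n choose k) ^ 2 * collision (square_exp x * square_exp y) k * collision G (n - k))"
      by (rule collision_mult)
    also have "\<dots> \<le> (\<Sum>k\<le>n. real (n choose k) ^ 2 * (C1 * (w ^ k) ^ 2 / sqrt (real k + 1)) * (s ^ (n - k)) ^ 2)"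
      using contracts_collision_le[OF G(1)] C1 nn
      by (intro sum_mono mult_mono mult_left_mono) (auto simp: G(2))
    also have "\<dots> = C1 * (\<Sum>k\<le>n. P n k ^ 2 * (1 / sqrt (real k + 1)))"
      unfolding sum_distrib_left
      by (intro sum.cong refl) (simp add: P_def power_mult_distrib)
    also have "(\<Sum>k\<le>n. P n k ^ 2 * (1 / sqrt (real k + 1))) \<le> (\<Sum>k\<le>n. P n k ^ 2 * ((r / (real k + 1) + 1 / r) / 2))"
      using inverse_sqrt_le[of "real k + 1" "real n + 1" for k]
      by (intro sum_mono mult_left_mono) (auto simp: r_def)
    also have "\<dots> = (r * (\<Sum>k\<le>n. P n k ^ 2 / (real k + 1)) + (\<Sum>k\<le>n. P n k ^ 2) / r) / 2"
      unfolding sum_distrib_left sum_divide_distrib sum.distrib[symmetric]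
      by (intro sum.cong refl) (simp add: field_simps)
    also have "\<dots> \<le> (r * (C2 / (w * (real n + 1) * r)) + (C2 / r) / r) / 2"
    proof -
      \<comment> \<open>Dividing by \<open>k + 1\<close> shifts the binomial weight to \<open>n + 1\<close>, up to the factor \<open>w (n + 1)\<close>.\<close>
      have "P n k ^ 2 / (real k + 1) \<le> (P n k ^ 2 + P (Suc n) (Suc k) ^ 2) / (2 * w * (real n + 1))" for k
      proof -
        have "real (Suc k) * real (Suc n choose Suc k) = real (Suc n) * real (n choose k)"
          using Suc_times_binomial_eq[of n k] by (metis of_nat_mult mult.commute)
        then have "real (Suc k) * real (Suc n choose Suc k) * (w ^ Suc k * s ^ (n - k))
            = real (Suc n) * real (n choose k) * (w ^ Suc k * s ^ (n - k))"
          by (simp only:)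
        then have "(real k + 1) * P (Suc n) (Suc k) = w * (real n + 1) * P n k"
          by (simp add: P_def mult_ac add.commute del: binomial_Suc_Suc)
        then have "P n k ^ 2 / (real k + 1) = P n k * P (Suc n) (Suc k) / (w * (real n + 1))"
          using w(1) by (simp add: divide_simps power2_eq_square mult_ac)
        moreover have "P n k * P (Suc n) (Suc k) \<le> (P n k ^ 2 + P (Suc n) (Suc k) ^ 2) / 2"
          using sum_squares_bound[of "P n k" "P (Suc n) (Suc k)"] by simp
        then have "P n k * P (Suc n) (Suc k) / (w * (real n + 1))
            \<le> (P n k ^ 2 + P (Suc n) (Suc k) ^ 2) / 2 / (w * (real n + 1))"
          using w(1) by (intro divide_right_mono) auto
        ultimately show ?thesis
          by (simp add: mult.assoc)
      qed
      then have "(\<Sum>k\<le>n. P n k ^ 2 / (real k + 1))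
          \<le> (\<Sum>k\<le>n. (P n k ^ 2 + P (Suc n) (Suc k) ^ 2) / (2 * w * (real n + 1)))"
        by (rule sum_mono)
      also have "\<dots> = ((\<Sum>k\<le>n. P n k ^ 2) + (\<Sum>k\<le>n. P (Suc n) (Suc k) ^ 2)) / (2 * w * (real n + 1))"
        by (simp add: sum_divide_distrib sum.distrib add_divide_distrib)
      also have "\<dots> \<le> (C2 / r + C2 / r) / (2 * w * (real n + 1))"
      proof (intro divide_right_mono add_mono)
        show "(\<Sum>k\<le>n. P n k ^ 2) \<le> C2 / r" using sumP[of n] by (simp add: r_def)
        have "(\<Sum>k\<le>n. P (Suc n) (Suc k) ^ 2) \<le> (\<Sum>k\<le>Suc n. P (Suc n) k ^ 2)"
          by (subst sum.atMost_Suc_shift) simp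
        also have "\<dots> \<le> C2 / sqrt (real (Suc n) + 1)" by (rule sumP)
        also have "\<dots> \<le> C2 / r"
          using C2(1) by (intro divide_left_mono) (auto simp: r_def)
        finally show "(\<Sum>k\<le>n. P (Suc n) (Suc k) ^ 2) \<le> C2 / r" .
      qed (use w in auto)
      also have "\<dots> = C2 / (w * (real n + 1) * r)"
        using r w by (simp add: divide_simps)
      finally show ?thesis
        using r sumP[of n] by (intro divide_right_mono add_mono mult_left_mono) (auto simp: r_def)
    qed
    also have "\<dots> = (C2 / w + C2) / 2 / (real n + 1)"
      using r w unfolding r(2)[symmetric] by (simp add: divide_simps)
    finally show ?thesis
      using C1(1) by (simp add: mult_left_mono)
  qed
  then show ?thesis by (rule that)
qed

section \<open>Schur convexity of the return probabilities\<close>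

definition type_series :: "'i set \<Rightarrow> ('i \<Rightarrow> real) \<Rightarrow> real fps" where
  "type_series I x = (\<Prod>i\<in>I. square_exp (x i))"

lemma type_series_nth_0 [simp]: "fps_nth (type_series I x) 0 = 1"
  unfolding type_series_def by (induction I rule: infinite_finite_induct) auto

lemma type_series_remove: "finite I \<Longrightarrow> i \<in> I \<Longrightarrow> type_series I x = square_exp (x i) * type_series (I - {i}) x"
  unfolding type_series_def by (rule prod.remove)

lemma contracts_type_series:
  assumes "finite I" "\<And>i. i \<in> I \<Longrightarrow> 0 \<le> x i"
  shows "contracts (\<Sum>i\<in>I. x i) (type_series I x)"
  using assms
proof (induction I)
  case empty
  then show ?case by (simp add: type_series_def contracts_1)
next
  case (insert i I)
  then show ?case
    using contracts_mult[OF contracts_square_exp[of "x i"], of "\<Sum>i\<in>I. x i" "type_series I x"]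
    by (simp add: type_series_def)
qed

lemma type_series_nonneg: "0 \<le> fps_nth (type_series I x) n"
proof (induction I arbitrary: n rule: infinite_finite_induct)
  case (insert i I)
  then show ?case
    by (simp add: type_series_def fps_mult_nth sum_nonneg square_exp_nonneg)
qed (auto simp: type_series_def)

lemma collision_type_series_pos:
  assumes "finite I" "(\<Sum>i\<in>I. x i) = 1" "\<And>i. i \<in> I \<Longrightarrow> 0 \<le> x i"
  shows "0 < collision (type_series I x) n"
proof -
  obtain i where i: "i \<in> I" "0 < x i"
    using assms by (metis less_eq_real_def sum_nonpos not_one_le_zero)
  have "fps_nth (square_exp (x i)) n * fps_nth (type_series (I - {i}) x) (n - n)
      \<le> fps_nth (square_exp (x i) * type_series (I - {i}) x) n"
    unfolding fps_mult_nth
    by (rule member_le_sum[where f = "\<lambda>k. fps_nth (square_exp (x i)) k * fps_nth (type_series (I - {i}) x) (n - k)"])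
      (auto intro!: mult_nonneg_nonneg square_exp_nonneg type_series_nonneg)
  moreover have "0 < fps_nth (square_exp (x i)) n"
    using i by (simp add: square_exp_def)
  ultimately show ?thesis
    using assms i by (simp add: collision_def type_series_remove)
qed

lemma collision_type_series_1: "finite I \<Longrightarrow> collision (type_series I x) 1 = (\<Sum>i\<in>I. x i ^ 2)"
proof (induction I rule: finite_induct)
  case (insert i I)
  then have "fps_nth (type_series I x) (Suc 0) = (\<Sum>i\<in>I. x i ^ 2)"
    by (simp add: collision_def)
  moreover have "type_series (insert i I) x = square_exp (x i) * type_series I x"
    using insert by (simp add: type_series_def)
  ultimately show ?case
    using insert by (simp add: collision_def fps_mult_nth) (simp add: square_exp_def)
qed (simp add: type_series_def collision_def)

definition robin_hood :: "nat \<Rightarrow> (nat \<Rightarrow> real) \<Rightarrow> (nat \<Rightarrow> real) \<Rightarrow> bool" where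
  "robin_hood d x x' \<longleftrightarrow> (\<exists>j<d. \<exists>k<d. \<exists>e>0. j \<noteq> k \<and> 0 \<le> x k \<and> x k + e \<le> x j - e \<and>
     x' = x(j := x j - e, k := x k + e))"

text \<open>
  All axes other than the two involved contribute a common factor with nonnegative coefficients.
\<close>

lemma type_series_robin_hood:
  assumes "robin_hood d x x'"
  shows "collision (type_series {..<d} x') n \<le> collision (type_series {..<d} x) n"
proof -
  obtain j k e where jk: "j < d" "k < d" "0 < e" "j \<noteq> k" "0 \<le> x k" "x k + e \<le> x j - e"
    and x': "x' = x(j := x j - e, k := x k + e)"
    using assms by (auto simp: robin_hood_def)
  define R where "R = type_series ({..<d} - {j} - {k}) x"
  have split: "type_series {..<d} z = square_exp (z j) * square_exp (z k) * type_series ({..<d} - {j} - {k}) z" for z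
    using jk by (simp add: type_series_remove mult.assoc)
  have "type_series ({..<d} - {j} - {k}) x' = R"
    unfolding R_def type_series_def by (intro prod.cong) (auto simp: x')
  then have "type_series {..<d} x' = square_exp (x j - e) * square_exp (x k + e) * R"
    using jk by (simp add: split[of x']) (simp add: x')
  moreover have "type_series {..<d} x = square_exp (x j) * square_exp (x k) * R"
    by (simp add: split R_def)
  moreover have "0 \<le> collision R m" for m
    by (simp add: R_def collision_def type_series_nonneg)
  ultimately show ?thesis
    using jk by (simp add: collision_mult[of _ R])
      (intro sum_mono mult_right_mono mult_left_mono collision_pair_antimono, auto)
qed

lemma sum_squares_robin_hood:
  assumes "robin_hood d x x'"
  shows "(\<Sum>i<d. x' i ^ 2) < (\<Sum>i<d. x i ^ 2)"
proof -
  obtain j k e where jk: "j < d" "k < d" "0 < e" "j \<noteq> k" "x k + e \<le> x j - e"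
    and x': "x' = x(j := x j - e, k := x k + e)"
    using assms by (auto simp: robin_hood_def)
  have split: "(\<Sum>i<d. z i ^ 2) = z j ^ 2 + (z k ^ 2 + (\<Sum>i\<in>{..<d} - {j} - {k}. z i ^ 2))"
    for z :: "nat \<Rightarrow> real"
    using jk by (simp add: sum.remove[of _ j] sum.remove[of _ k])
  have "(\<Sum>i\<in>{..<d} - {j} - {k}. x' i ^ 2) = (\<Sum>i\<in>{..<d} - {j} - {k}. x i ^ 2)"
    by (intro sum.cong) (auto simp: x')
  moreover have "(x j - e) ^ 2 + (x k + e) ^ 2 < x j ^ 2 + x k ^ 2"
  proof -
    have "0 < 2 * e * (x j - x k - e)"
      using jk by (intro mult_pos_pos) auto
    then show ?thesis by (simp add: power2_eq_square algebra_simps)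
  qed
  ultimately show ?thesis
    using jk unfolding split[of x] split[of x'] by (simp add: x')
qed

text \<open>
  Let \<open>k\<close> be the first coordinate with \<open>x k < y k\<close> and \<open>j\<close> the last
  coordinate before \<open>k\<close> with \<open>x j > y j\<close>; \<open>x\<close> and \<open>y\<close> agree strictly between them. Moving the smaller of
  the two differences from \<open>j\<close> to \<open>k\<close> makes at least one more coordinate agree. It lowers only the partial sums that
  end between \<open>j\<close> and \<open>k\<close>, and those exceed the partial sums of \<open>y\<close> by at least \<open>x j - y j\<close>.
\<close>

lemma robin_hood_chain:
  assumes "\<And>i j. i \<le> j \<Longrightarrow> j < d \<Longrightarrow> y j \<le> y i"
    and "\<And>i. i < d \<Longrightarrow> 0 \<le> x i"
    and "\<And>n. n \<le> d \<Longrightarrow> (\<Sum>i<n. y i) \<le> (\<Sum>i<n. x i)"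
    and "(\<Sum>i<d. x i) = (\<Sum>i<d. y i)"
  shows "\<exists>x'. (robin_hood d)\<^sup>*\<^sup>* x x' \<and> (\<forall>i<d. x' i = y i)"
  using assms
proof (induction "card {i. i < d \<and> x i \<noteq> y i}" arbitrary: x rule: less_induct)
  case less
  note y = less.prems(1) and nonneg = less.prems(2) and part = less.prems(3) and total = less.prems(4)
  show ?case
  proof (cases "\<forall>i<d. x i = y i")
    case True
    then show ?thesis by blast
  next
    case False
    define Q where "Q i \<longleftrightarrow> i < d \<and> x i < y i" for i
    have "\<exists>i. Q i"
    proof (rule ccontr)
      assume "\<not> (\<exists>i. Q i)"
      then have ge: "y i \<le> x i" if "i < d" for i
        using that \<open>\<not> (\<exists>i. Q i)\<close> unfolding Q_def by (meson not_le)
      obtain i where "i < d" "x i \<noteq> y i" using False by blast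
      then have "(\<Sum>i<d. y i) < (\<Sum>i<d. x i)"
        using ge by (intro sum_strict_mono_ex1) (auto intro!: bexI[of _ i] simp: less_le)
      with total show False by simp
    qed
    define k where "k = (LEAST i. Q i)"
    have "Q k" unfolding k_def using \<open>\<exists>i. Q i\<close> by (rule LeastI_ex)
    then have k: "k < d" "x k < y k" by (auto simp: Q_def)
    have below_k: "y i \<le> x i" if "i < k" for i
      using not_less_Least[of i Q] that k by (fastforce simp: Q_def k_def[symmetric])
    define J where "J = {j. j < k \<and> y j < x j}"
    have "J \<noteq> {}"
    proof
      assume "J = {}"
      then have "(\<Sum>i<k. x i) = (\<Sum>i<k. y i)"
        using below_k by (intro sum.cong) (fastforce simp: J_def)+
      then have "(\<Sum>i<Suc k. x i) < (\<Sum>i<Suc k. y i)" using k by simp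
      with part[of "Suc k"] k show False by simp
    qed
    moreover have "finite J" by (simp add: J_def)
    ultimately have "Max J \<in> J" by (rule Max_in[rotated])
    define j where "j = Max J"
    have j: "j < k" "y j < x j"
      using \<open>Max J \<in> J\<close> by (auto simp: j_def J_def)
    have between: "x i = y i" if "j < i" "i < k" for i
    proof -
      have "i \<notin> J"
        using Max_ge[OF \<open>finite J\<close>, of i] that by (auto simp: j_def)
      then show ?thesis using below_k[of i] that by (auto simp: J_def)
    qed
    define e where "e = min (x j - y j) (y k - x k)"
    have e: "0 < e" "e \<le> x j - y j" "e \<le> y k - x k"
      using j k by (auto simp: e_def)
    define x' where "x' = x(j := x j - e, k := x k + e)"
    have yjk: "y k \<le> y j" using y[of j k] j k by simp
    have step: "robin_hood d x x'"
      unfolding robin_hood_def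
      using j k e nonneg[of k] yjk by (intro exI[of _ j] exI[of _ k] exI[of _ e] conjI) (auto simp: x'_def)
    have sums: "(\<Sum>i<n. x' i) = (\<Sum>i<n. x i) - (if j < n then e else 0) + (if k < n then e else 0)" for n
    proof -
      have "x' i = x i - (if i = j then e else 0) + (if i = k then e else 0)" for i
        using j by (auto simp: x'_def)
      then show ?thesis by (simp add: sum.distrib sum_subtractf)
    qed
    have "card {i. i < d \<and> x' i \<noteq> y i} < card {i. i < d \<and> x i \<noteq> y i}"
    proof (rule psubset_card_mono)
      have "x' j = y j \<or> x' k = y k"
        using j by (auto simp: x'_def e_def min_def)
      moreover have "x' i = x i" if "i \<noteq> j" "i \<noteq> k" for i
        using that by (simp add: x'_def)
      moreover have "x j \<noteq> y j" "x k \<noteq> y k" "j < d" "k < d"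
        using j k by simp_all
      ultimately show "{i. i < d \<and> x' i \<noteq> y i} \<subset> {i. i < d \<and> x i \<noteq> y i}"
        by (smt (verit) mem_Collect_eq psubsetI subsetI)
    qed simp
    moreover have "0 \<le> x' i" if "i < d" for i
      using that nonneg[of i] nonneg[of k] e k j yjk by (auto simp: x'_def)
    moreover have "(\<Sum>i<n. y i) \<le> (\<Sum>i<n. x' i)" if "n \<le> d" for n
    proof (cases "j < n \<and> n \<le> k")
      case True
      have split: "(\<Sum>i<n. z i) = (\<Sum>i<j. z i) + z j + (\<Sum>i=Suc j..<n. z i)" for z :: "nat \<Rightarrow> real"
        using True sum.atLeastLessThan_concat[of 0 "Suc j" n z]
        by (simp add: atLeast0LessThan)
      have "(\<Sum>i=Suc j..<n. x i) = (\<Sum>i=Suc j..<n. y i)"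
        using True by (intro sum.cong between) auto
      then show ?thesis
        using True e part[of j] j k unfolding sums split[of x] split[of y] by simp
    next
      case False
      then show ?thesis using part[OF that] j by (auto simp: sums)
    qed
    moreover have "(\<Sum>i<d. x' i) = (\<Sum>i<d. y i)"
      using total j k by (simp add: sums)
    ultimately obtain z where "(robin_hood d)\<^sup>*\<^sup>* x' z" "\<forall>i<d. z i = y i"
      using less.hyps[of x'] y by blast
    with step show ?thesis
      by (meson converse_rtranclp_into_rtranclp)
  qed
qed

text \<open>
  The probability of being at the origin at time \<open>2 n\<close>; see \<open>prob_walk_zero\<close> below. The
  factor \<open>central n\<close> is the probability that \<open>n\<close> of the \<open>2 n\<close> steps are positive, and then the
  positive and the negative steps must have the same type.
\<close>

definition return_prob :: "nat \<Rightarrow> (nat \<Rightarrow> real) \<Rightarrow> nat \<Rightarrow> real" where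
  "return_prob d x n = central n * collision (type_series {..<d} x) n"

lemma return_prob_cong: "(\<And>i. i < d \<Longrightarrow> x i = y i) \<Longrightarrow> return_prob d x n = return_prob d y n"
  unfolding return_prob_def type_series_def by (metis (no_types, lifting) lessThan_iff prod.cong)

lemma return_prob_1: "return_prob d x 1 = (\<Sum>i<d. x i ^ 2) / 2"
  using collision_type_series_1[of "{..<d}" x] by (simp add: return_prob_def central_def)

lemma return_prob_majorize:
  assumes y: "\<And>i j. i \<le> j \<Longrightarrow> j < d \<Longrightarrow> y j \<le> y i"
    and x: "\<And>i. i < d \<Longrightarrow> 0 \<le> x i"
    and part: "\<And>n. n \<le> d \<Longrightarrow> (\<Sum>i<n. y i) \<le> (\<Sum>i<n. x i)"
    and total: "(\<Sum>i<d. x i) = (\<Sum>i<d. y i)"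
    and ne: "\<exists>i<d. x i \<noteq> y i"
  shows "return_prob d y n \<le> return_prob d x n" "return_prob d y 1 < return_prob d x 1"
proof -
  obtain z where z: "(robin_hood d)\<^sup>*\<^sup>* x z" "\<And>i. i < d \<Longrightarrow> z i = y i"
    using robin_hood_chain[OF y x part total] by blast
  have "return_prob d z n \<le> return_prob d x n"
    using z(1)
  proof (induction rule: rtranclp_induct)
    case (step u v)
    have "return_prob d v n \<le> return_prob d u n"
      unfolding return_prob_def
      by (intro mult_left_mono type_series_robin_hood[OF step(2)] less_imp_le[OF central_pos])
    with step(3) show ?case by simp
  qed simp
  then show "return_prob d y n \<le> return_prob d x n"
    using return_prob_cong[of d z y] z(2) by simp
  have "z \<noteq> x" using ne z(2) by auto
  then have "(robin_hood d)\<^sup>+\<^sup>+ x z"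
    using z(1) by (metis rtranclpD)
  then have "return_prob d z 1 < return_prob d x 1"
  proof (induction rule: tranclp_induct)
    case (base u)
    then show ?case using sum_squares_robin_hood[OF base] unfolding return_prob_1 by simp
  next
    case (step u v)
    then show ?case using step(3) sum_squares_robin_hood[OF step(2)] unfolding return_prob_1 by simp
  qed
  then show "return_prob d y 1 < return_prob d x 1"
    using return_prob_cong[of d z y] z(2) by simp
qed

section \<open>Summability of the return probabilities\<close>

lemma collision_type_series_decseq:
  fixes d :: nat
  assumes "(\<Sum>i<d. x i) = 1" "\<And>i. i < d \<Longrightarrow> 0 \<le> x i"
  shows "decseq (collision (type_series {..<d} x))"
proof -
  have "contracts 1 (type_series {..<d} x)"
    using contracts_type_series[OF finite_lessThan[of d], of x] assms by simp
  then show ?thesis by (auto simp: decseq_Suc_iff contracts_def)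
qed

lemma return_prob_pos:
  assumes "(\<Sum>i<d. x i) = 1" "\<And>i. i < d \<Longrightarrow> 0 \<le> x i"
  shows "0 < return_prob d x n"
  using collision_type_series_pos[of "{..<d}" x n] assms central_pos by (simp add: return_prob_def)

text \<open>
  With at most two active axes the collision probability is at least that of two equal axes, which is
  \<open>central n\<close> again.
\<close>

lemma not_summable_return_prob:
  assumes x: "(\<Sum>i<d. x i) = 1" "\<And>i. i < d \<Longrightarrow> 0 \<le> x i"
    and few: "card {i. i < d \<and> x i \<noteq> 0} < 3"
  shows "\<not> summable (return_prob d x)"
proof -
  define I where "I = {i. i < d \<and> x i \<noteq> 0}"
  have type_series_I: "type_series {..<d} x = type_series I x"
    unfolding type_series_def by (rule prod.mono_neutral_right) (auto simp: I_def)
  have "(\<Sum>i<d. x i) = (\<Sum>i\<in>I. x i)"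
    by (rule sum.mono_neutral_right) (auto simp: I_def)
  then have sum_I: "(\<Sum>i\<in>I. x i) = 1" using x by simp
  have "finite I" by (simp add: I_def)
  have "card I \<noteq> 0" using sum_I \<open>finite I\<close> by auto
  then consider "card I = 1" | "card I = 2" using few by (fastforce simp: I_def[symmetric])
  then obtain p q where pq: "0 \<le> p" "0 \<le> q" "p + q = 1" "type_series I x = square_exp p * square_exp q"
  proof cases
    case 1
    then obtain a where "I = {a}" by (auto simp: card_1_singleton_iff)
    then show ?thesis
      using that[of "x a" 0] x sum_I by (simp add: type_series_def)
  next
    case 2
    then obtain a b where "I = {a, b}" "a \<noteq> b" by (auto simp: card_2_iff)
    moreover from this have "a < d" "b < d" by (auto simp: I_def)
    ultimately show ?thesis
      using that[of "x a" "x b"] x sum_I by (simp add: type_series_def)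
  qed
  have lower: "1 / 4 * inverse (real (Suc n)) \<le> return_prob d x (Suc n)" for n
  proof -
    have "1 / 4 * inverse (real (Suc n)) \<le> central (Suc n) ^ 2"
      using central_lower[of "Suc n"] by (simp add: field_simps)
    also have "\<dots> \<le> return_prob d x (Suc n)"
      unfolding return_prob_def type_series_I pq(4) power2_eq_square
      using collision_pair_ge[OF pq(1-3)] central_pos[of "Suc n"] by (intro mult_left_mono) auto
    finally show ?thesis .
  qed
  show ?thesis
  proof
    assume "summable (return_prob d x)"
    then have "summable (\<lambda>n. return_prob d x (Suc n))"
      by (subst summable_Suc_iff)
    then have "summable (\<lambda>n. 1 / 4 * inverse (real (Suc n)))"
      by (rule summable_comparison_test'[where N = 0]) (use lower in auto)
    then have "summable (\<lambda>n. inverse (real (Suc n)))"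
      by (simp only: summable_cmult_iff) simp
    then show False
      using not_summable_harmonic[where 'a = real] summable_Suc_iff[of "\<lambda>n. inverse (real n)"] by blast
  qed
qed

lemma summable_return_prob:
  assumes x: "(\<Sum>i<d. x i) = 1" "\<And>i. i < d \<Longrightarrow> 0 \<le> x i"
    and many: "3 \<le> card {i. i < d \<and> x i \<noteq> 0}"
  shows "summable (return_prob d x)"
proof -
  obtain T where "T \<subseteq> {i. i < d \<and> x i \<noteq> 0}" "card T = 3"
    using obtain_subset_with_card_n[OF many] by metis
  then obtain a b c where abc: "a \<noteq> b" "b \<noteq> c" "a \<noteq> c" "a < d" "b < d" "c < d"
    "x a \<noteq> 0" "x b \<noteq> 0" "x c \<noteq> 0"
    by (auto simp: card_3_iff)
  then have pos: "0 < x a" "0 < x b" "0 < x c"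
    using x(2) by (auto simp: less_le)
  define R where "R = {..<d} - {a} - {b}"
  have R: "finite R" "c \<in> R" using abc by (auto simp: R_def)
  have "x c \<le> (\<Sum>i\<in>R. x i)"
    using R x(2) by (intro member_le_sum) (auto simp: R_def)
  then have sR: "0 < (\<Sum>i\<in>R. x i)" using pos by simp
  have sum1: "x a + x b + (\<Sum>i\<in>R. x i) = 1"
    using x(1) abc by (simp add: R_def sum.remove[of _ a] sum.remove[of _ b])
  have "contracts (\<Sum>i\<in>R. x i) (type_series R x)"
    using R x(2) by (intro contracts_type_series) (auto simp: R_def)
  with pos sR sum1 obtain C
    where C: "\<And>n. collision (square_exp (x a) * square_exp (x b) * type_series R x) n \<le> C / (real n + 1)"
    using collision_triple_le[of "x a" "x b" "\<Sum>i\<in>R. x i" "type_series R x"] by auto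
  have ax: "type_series {..<d} x = square_exp (x a) * square_exp (x b) * type_series R x"
    using abc by (simp add: R_def type_series_remove mult.assoc)
  have upper: "return_prob d x n \<le> C * real (Suc n) powr (- (3/2))" for n
  proof -
    have "0 \<le> collision (type_series {..<d} x) n" by (simp add: collision_def type_series_nonneg)
    then have "return_prob d x n \<le> 1 / sqrt (real n + 1) * (C / (real n + 1))"
      unfolding return_prob_def using central_upper[of n] C[of n] central_pos[of n]
      by (intro mult_mono) (auto simp: ax)
    also have "\<dots> = C * real (Suc n) powr (- (3/2))"
    proof -
      define z where "z = real n + 1"
      have "z powr (3/2) = z powr (1/2) * z powr 1"
        by (simp only: powr_add[symmetric]) simp
      also have "\<dots> = sqrt z * z"
        by (simp add: powr_half_sqrt z_def)
      finally have "z powr (- (3/2)) = 1 / (sqrt z * z)"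
        by (simp only: powr_minus_divide)
      moreover have "1 / sqrt z * (C / z) = C * (1 / (sqrt z * z))"
        by simp
      moreover have "real (Suc n) = z" by (simp add: z_def)
      ultimately show ?thesis by (simp only: z_def)
    qed
    finally show ?thesis .
  qed
  have "summable (\<lambda>n. real n powr (- (3/2)))"
    by (simp add: summable_real_powr_iff)
  then have "summable (\<lambda>n. real (Suc n) powr (- (3/2)))"
    by (subst summable_Suc_iff)
  then have "summable (\<lambda>n. C * real (Suc n) powr (- (3/2)))"
    by (rule summable_mult)
  then show ?thesis
    by (rule summable_comparison_test'[where N = 0])
      (use upper return_prob_pos[OF x] in \<open>auto simp: less_imp_le abs_of_pos\<close>)
qed

section \<open>Comparison of renewal sequences\<close>

definition renewal :: "(nat \<Rightarrow> real) \<Rightarrow> (nat \<Rightarrow> real) \<Rightarrow> bool" where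
  "renewal u g \<longleftrightarrow> u 0 = 1 \<and> (\<forall>n. 0 \<le> u n) \<and> (\<forall>n. 0 \<le> g n) \<and> decseq g \<and>
     (\<forall>n. (\<Sum>k\<le>n. u k * g (n - k)) = 1)"

lemma renewal_fps:
  assumes "renewal u g"
  shows "Abs_fps u * ((1 - fps_X) * Abs_fps g) = 1"
proof -
  have "Abs_fps u * Abs_fps g = Abs_fps (\<lambda>_. 1)"
    using assms by (intro fps_ext) (simp add: renewal_def fps_mult_nth atLeast0AtMost)
  moreover have "(1 - fps_X) * Abs_fps (\<lambda>_. 1 :: real) = 1"
    by (rule fps_ext) (simp add: left_diff_distrib)
  ultimately show ?thesis by (metis mult.left_commute)
qed

text \<open>
  The series \<open>D = (1 - z) G\<close> is \<open>1 / U\<close>, and its coefficients after the first are nonpositive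
  because \<open>g\<close> is decreasing. As \<open>b\<close> is decreasing, \<open>u n * a k \<le> a n * u k\<close> for \<open>k \<le> n\<close>. Hence
  \<open>u n * (\<Sum>k\<le>n. a k * D (n - k))\<close> is at least \<open>a n * (\<Sum>k\<le>n. u k * D (n - k))\<close>, where the last sum
  is a coefficient of \<open>U D = 1\<close>.
\<close>

lemma renewal_quotient_nonneg:
  assumes ren: "renewal u g" and a: "\<And>n. 0 < a n" and u: "\<And>n. u n = a n * b n"
    and b: "decseq b" "\<And>n. 0 < b n"
  shows "0 \<le> fps_nth (Abs_fps a * ((1 - fps_X) * Abs_fps g)) n"
proof -
  define D where "D = (1 - fps_X) * Abs_fps g"
  have D: "fps_nth D k = g k - (if k = 0 then 0 else g (k - 1))" for k
    by (simp add: D_def left_diff_distrib)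
  have D_le: "fps_nth D k \<le> 0" if "k \<noteq> 0" for k
    using ren that unfolding D renewal_def decseq_def by simp
  have "a n * fps_nth (Abs_fps u * D) n \<le> u n * fps_nth (Abs_fps a * D) n"
  proof -
    have "a n * (u k * fps_nth D (n - k)) \<le> u n * (a k * fps_nth D (n - k))" if "k \<le> n" for k
    proof (cases "k = n")
      case False
      then have "fps_nth D (n - k) \<le> 0" using that by (intro D_le) auto
      moreover have "u n * a k \<le> a n * u k"
      proof -
        have "(a n * a k) * b n \<le> (a n * a k) * b k"
          using a[of n] a[of k] decseqD[OF b(1) that] by (intro mult_left_mono) auto
        then show ?thesis by (simp add: u mult_ac)
      qed
      ultimately show ?thesis
        using mult_right_mono_neg[of "u n * a k" "a n * u k" "fps_nth D (n - k)"]
        by (simp add: mult.assoc)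
    qed simp
    then show ?thesis
      unfolding fps_mult_nth sum_distrib_left by (intro sum_mono) auto
  qed
  moreover have "0 \<le> a n * fps_nth (Abs_fps u * D) n"
    using less_imp_le[OF a[of n]] renewal_fps[OF ren] by (simp add: D_def)
  ultimately have "0 \<le> u n * fps_nth (Abs_fps a * D) n"
    by linarith
  moreover have "0 < u n"
    using a b by (simp add: u)
  ultimately show ?thesis
    unfolding D_def[symmetric] by (simp add: zero_le_mult_iff)
qed

text \<open>
  Both factors \<open>A * D\<close> in the identity for \<open>k - g\<close> are nonnegative quotients; the identity uses
  \<open>A^2 = 1 / (1 - z)\<close>.
\<close>

lemma renewal_mono:
  assumes u: "renewal u g" "\<And>n. u n = central n * b n" "decseq b" "\<And>n. 0 < b n"
    and v: "renewal v k" "\<And>n. v n = central n * c n" "decseq c" "\<And>n. 0 < c n"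
    and le: "\<And>n. v n \<le> u n"
  shows "g n \<le> k n"
proof -
  define A where "A = Abs_fps central"
  define D where "D g = (1 - fps_X) * Abs_fps g" for g :: "nat \<Rightarrow> real"
  have geo: "A ^ 2 * (1 - fps_X) = 1"
    unfolding A_def central_square by (rule fps_ext) (simp add: right_diff_distrib)
  have inv: "Abs_fps u * D g = 1" "Abs_fps v * D k = 1"
    using renewal_fps u(1) v(1) by (auto simp: D_def)
  have "(A * D g) * (A * D k) * (Abs_fps u - Abs_fps v)
      = A ^ 2 * (D k * (Abs_fps u * D g) - D g * (Abs_fps v * D k))"
    by (simp add: power2_eq_square algebra_simps)
  also have "\<dots> = A ^ 2 * (1 - fps_X) * (Abs_fps k - Abs_fps g)"
    unfolding inv by (simp add: D_def algebra_simps)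
  also have "\<dots> = Abs_fps k - Abs_fps g"
    by (simp add: geo)
  finally have eq: "Abs_fps k - Abs_fps g = (A * D g) * (A * D k) * (Abs_fps u - Abs_fps v)" ..
  have nonneg: "0 \<le> fps_nth (A * D g) m" "0 \<le> fps_nth (A * D k) m" for m
    unfolding A_def D_def
    using renewal_quotient_nonneg[OF u(1) central_pos u(2-4)]
      renewal_quotient_nonneg[OF v(1) central_pos v(2-4)] by blast+
  have nonneg2: "0 \<le> fps_nth ((A * D g) * (A * D k)) m" for m
    unfolding fps_mult_nth[of "A * D g"] by (intro sum_nonneg mult_nonneg_nonneg nonneg)
  have "0 \<le> fps_nth ((A * D g) * (A * D k) * (Abs_fps u - Abs_fps v)) n"
    unfolding fps_mult_nth[of "(A * D g) * (A * D k)"]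
    by (intro sum_nonneg mult_nonneg_nonneg nonneg2) (simp add: le)
  then show ?thesis
    unfolding eq[symmetric] by simp
qed

lemma renewal_limit_le:
  assumes ren: "renewal u g" and lim: "g \<longlonglongrightarrow> L"
  shows "L * (\<Sum>k\<le>n. u k) \<le> 1"
proof -
  have "L \<le> g k" for k
    using ren lim by (intro decseq_ge) (auto simp: renewal_def)
  then have "(\<Sum>k\<le>n. u k * L) \<le> (\<Sum>k\<le>n. u k * g (n - k))"
    using ren by (intro sum_mono mult_left_mono) (auto simp: renewal_def)
  then show ?thesis
    using ren by (simp add: renewal_def sum_distrib_left mult.commute)
qed

lemma renewal_recurrent:
  assumes ren: "renewal u g" and lim: "g \<longlonglongrightarrow> L" and u: "\<not> summable u"
  shows "L = 0"
proof (rule ccontr)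
  assume "L \<noteq> 0"
  moreover have "0 \<le> L"
    using ren by (intro LIMSEQ_le_const[OF lim]) (auto simp: renewal_def)
  ultimately have "0 < L" by simp
  then have "(\<Sum>k\<le>n. u k) \<le> 1 / L" for n
    using renewal_limit_le[OF ren lim, of n] by (simp add: field_simps)
  then have "(\<Sum>k<n. u k) \<le> 1 / L" for n
    using ren by (intro order_trans[OF sum_mono2[of "{..n}" "{..<n}" u]]) (auto simp: renewal_def)
  then have "summable u"
    using ren by (intro summableI_nonneg_bounded) (auto simp: renewal_def)
  with u show False ..
qed

text \<open>
  In the renewal equation at \<open>2 m\<close>, the terms with \<open>k < m\<close> carry a factor at most \<open>g m\<close>, and the
  others are bounded by the tail of the convergent series.
\<close>

lemma renewal_transient:
  assumes ren: "renewal u g" and lim: "g \<longlonglongrightarrow> L" and u: "summable u"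
  shows "1 \<le> L * (\<Sum>k. u k)"
proof -
  define S where "S = (\<Sum>k. u k)"
  have nn: "0 \<le> u n" "0 \<le> g n" for n using ren by (auto simp: renewal_def)
  have "(\<Sum>k\<le>0. u k * g (0 - k)) = 1" "u 0 = 1"
    using ren unfolding renewal_def by blast+
  then have g0: "g 0 = 1" by simp
  have le: "1 \<le> g m * S + (S - (\<Sum>k<m. u k))" for m
  proof -
    have "1 = (\<Sum>k\<le>2 * m. u k * g (2 * m - k))"
      using ren by (simp add: renewal_def)
    also have "\<dots> \<le> (\<Sum>k\<le>2 * m. u k * g m + (if k < m then 0 else u k))"
    proof (rule sum_mono)
      fix k assume "k \<in> {..2 * m}"
      show "u k * g (2 * m - k) \<le> u k * g m + (if k < m then 0 else u k)"
      proof (cases "k < m")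
        case True
        then have "g (2 * m - k) \<le> g m"
          using ren by (auto simp: renewal_def decseq_def)
        then show ?thesis using True nn by (simp add: mult_left_mono)
      next
        case False
        have "g (2 * m - k) \<le> 1"
          using ren g0 by (metis decseqD le0 renewal_def)
        then have "u k * g (2 * m - k) \<le> u k" using nn by (simp add: mult_left_le)
        moreover have "0 \<le> u k * g m" using nn by simp
        ultimately show ?thesis using False by simp
      qed
    qed
    also have "\<dots> = g m * (\<Sum>k\<le>2 * m. u k) + ((\<Sum>k\<le>2 * m. u k) - (\<Sum>k<m. u k))"
    proof -
      have "(\<Sum>k\<le>2 * m. if k < m then 0 else u k) = (\<Sum>k\<le>2 * m. u k - (if k < m then u k else 0))"
        by (intro sum.cong) auto
      also have "\<dots> = (\<Sum>k\<le>2 * m. u k) - (\<Sum>k<m. u k)"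
        unfolding sum_subtractf
        by (subst sum.mono_neutral_cong_right[of "{..2 * m}" "{..<m}" "\<lambda>k. if k < m then u k else 0" u]) auto
      finally show ?thesis
        by (simp add: sum.distrib sum_distrib_left mult.commute)
    qed
    also have "\<dots> \<le> g m * S + (S - (\<Sum>k<m. u k))"
      using u nn unfolding S_def
      by (intro add_mono diff_right_mono mult_left_mono sum_le_suminf) auto
    finally show ?thesis .
  qed
  have "(\<lambda>m. g m * S + (S - (\<Sum>k<m. u k))) \<longlonglongrightarrow> L * S + (S - S)"
    unfolding S_def using u lim by (intro tendsto_intros summable_LIMSEQ)
  then show ?thesis
    using le by (intro LIMSEQ_le_const) (auto simp: S_def)
qed

section \<open>Counting closed paths\<close>

primrec line_paths :: "nat \<Rightarrow> int \<Rightarrow> real" where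
  "line_paths 0 m = of_bool (m = 0)"
| "line_paths (Suc n) m = line_paths n (m - 1) + line_paths n (m + 1)"

lemma line_paths_parity: "odd (int n + m) \<Longrightarrow> line_paths n m = 0"
  by (induction n arbitrary: m) auto

lemma line_paths_far: "m < - int n \<Longrightarrow> line_paths n m = 0"
  by (induction n arbitrary: m) auto

lemma line_paths_binomial: "line_paths n (2 * int k - int n) = real (n choose k)"
proof (induction n arbitrary: k)
  case 0
  then show ?case by (cases k) auto
next
  case (Suc n)
  show ?case
  proof (cases k)
    case 0
    have "line_paths n (- int n - 2) = 0" by (rule line_paths_far) simp
    then show ?thesis using Suc.IH[of 0] 0 by (simp add: algebra_simps)
  next
    case (Suc j)
    have "2 * int k - int (Suc n) - 1 = 2 * int j - int n"
      "2 * int k - int (Suc n) + 1 = 2 * int (Suc j) - int n"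
      using Suc by auto
    then have "line_paths (Suc n) (2 * int k - int (Suc n))
        = line_paths n (2 * int j - int n) + line_paths n (2 * int (Suc j) - int n)"
      by (simp only: line_paths.simps)
    then show ?thesis using Suc.IH[of j] Suc.IH[of "Suc j"] Suc by simp
  qed
qed

text \<open>
  The power series of the modified Bessel function of order \<open>m\<close> at \<open>x t\<close>: the exponential
  generating function of the one-dimensional paths to \<open>m\<close>, each step having weight \<open>x / 2\<close>.
\<close>

definition bessel :: "real \<Rightarrow> int \<Rightarrow> real fps" where
  "bessel x m = Abs_fps (\<lambda>n. (x / 2) ^ n / fact n * line_paths n m)"

lemma bessel_deriv:
  "fps_deriv (bessel x m) = fps_const (x / 2) * (bessel x (m - 1) + bessel x (m + 1))"
  by (rule fps_ext) (simp add: bessel_def field_simps del: of_nat_Suc)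

text \<open>
  At the origin only even lengths occur, and \<open>1 / (2 k)! * (2 k choose k) = (1 / k!)^2\<close>.
\<close>

lemma bessel_0: "bessel x 0 = square_exp x oo (fps_const (1 / 4) * fps_X ^ 2)"
proof (rule fps_ext)
  fix n
  have pow: "fps_nth ((fps_const (1 / 4 :: real) * fps_X ^ 2) ^ i) n = (1 / 4) ^ i * of_bool (n = 2 * i)" for i
    by (simp add: power_mult_distrib power_mult[symmetric] fps_X_power_nth)
  show "fps_nth (bessel x 0) n = fps_nth (square_exp x oo (fps_const (1 / 4) * fps_X ^ 2)) n"
  proof (cases "even n")
    case True
    then obtain k where n: "n = 2 * k" by (elim evenE)
    have "fps_nth (square_exp x oo (fps_const (1 / 4) * fps_X ^ 2)) n
        = (\<Sum>i=0..n. if i = k then fps_nth (square_exp x) k * (1 / 4) ^ k else 0)"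
      unfolding fps_compose_nth pow by (intro sum.cong) (auto simp: n)
    also have "\<dots> = fps_nth (square_exp x) k * (1 / 4) ^ k"
      by (simp add: n)
    also have "\<dots> = (x / 2) ^ (2 * k) / fact (2 * k) * real ((2 * k) choose k)"
      by (simp add: square_exp_def binomial_fact power_mult power_divide power2_eq_square power_mult_distrib)
    also have "\<dots> = fps_nth (bessel x 0) n"
      using line_paths_binomial[of n k] by (simp add: bessel_def n)
    finally show ?thesis ..
  next
    case False
    then have "n \<noteq> 2 * i" for i by auto
    then show ?thesis
      unfolding fps_compose_nth pow using False by (simp add: bessel_def line_paths_parity)
  qed
qed

lemma prod_bessel_0_nth:
  "fps_nth (\<Prod>i\<in>I. bessel (x i) 0) (2 * n) = fps_nth (type_series I x) n / 4 ^ n"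
  "fps_nth (\<Prod>i\<in>I. bessel (x i) 0) (2 * n + 1) = 0"
proof -
  have eq: "(\<Prod>i\<in>I. bessel (x i) 0) = type_series I x oo (fps_const (1 / 4) * fps_X ^ 2)"
    by (simp add: bessel_0 type_series_def fps_compose_prod_distrib)
  have pow: "fps_nth ((fps_const (1 / 4 :: real) * fps_X ^ 2) ^ i) n = (1 / 4) ^ i * of_bool (n = 2 * i)" for i n
    by (simp add: power_mult_distrib power_mult[symmetric] fps_X_power_nth)
  have "fps_nth (\<Prod>i\<in>I. bessel (x i) 0) (2 * n)
      = (\<Sum>i=0..2*n. if i = n then fps_nth (type_series I x) n * (1 / 4) ^ n else 0)"
    unfolding eq fps_compose_nth pow by (intro sum.cong) auto
  then show "fps_nth (\<Prod>i\<in>I. bessel (x i) 0) (2 * n) = fps_nth (type_series I x) n / 4 ^ n"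
    by (simp add: power_divide)
  have "\<And>i. 2 * n + 1 \<noteq> 2 * i" by presburger
  then show "fps_nth (\<Prod>i\<in>I. bessel (x i) 0) (2 * n + 1) = 0"
    unfolding eq fps_compose_nth pow by simp
qed

lemma fps_deriv_prod:
  fixes f :: "'i \<Rightarrow> 'a :: comm_ring_1 fps"
  assumes "finite I"
  shows "fps_deriv (\<Prod>i\<in>I. f i) = (\<Sum>i\<in>I. fps_deriv (f i) * (\<Prod>k\<in>I - {i}. f k))"
  using assms
proof (induction I)
  case (insert j I)
  have "(\<Sum>i\<in>I. fps_deriv (f i) * (\<Prod>k\<in>insert j I - {i}. f k))
      = (\<Sum>i\<in>I. f j * (fps_deriv (f i) * (\<Prod>k\<in>I - {i}. f k)))"
  proof (intro sum.cong refl)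
    fix i assume "i \<in> I"
    then have "insert j I - {i} = insert j (I - {i})" using insert by auto
    then show "fps_deriv (f i) * (\<Prod>k\<in>insert j I - {i}. f k)
        = f j * (fps_deriv (f i) * (\<Prod>k\<in>I - {i}. f k))"
      using insert by (simp add: mult_ac)
  qed
  moreover have "insert j I - {j} = I" using insert by auto
  ultimately show ?case
    using insert by (simp add: sum_distrib_left mult.commute)
qed simp

text \<open>
  Interleaving independent coordinates multiplies exponential generating functions, so this is
  the exponential generating function of the paths in \<open>\<int>\<^sup>d\<close> to \<open>v\<close>
  (\<open>path_sum_endpoint\<close>). Differentiating it removes one step, which replaces the
  combinatorics of interleaving by the product rule.
\<close>

definition bessel_prod :: "nat \<Rightarrow> (nat \<Rightarrow> real) \<Rightarrow> (nat \<Rightarrow> int) \<Rightarrow> real fps" where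
  "bessel_prod d x v = (\<Prod>i<d. bessel (x i) (v i))"

lemma bessel_prod_deriv:
  "fps_deriv (bessel_prod d x v) = (\<Sum>i<d. fps_const (x i / 2)
     * (bessel_prod d x (v(i := v i - 1)) + bessel_prod d x (v(i := v i + 1))))"
proof -
  have upd: "bessel_prod d x (v(i := m)) = bessel (x i) m * (\<Prod>k\<in>{..<d} - {i}. bessel (x k) (v k))"
    if "i < d" for i m
  proof -
    have "bessel_prod d x (v(i := m))
        = bessel (x i) m * (\<Prod>k\<in>{..<d} - {i}. bessel (x k) ((v(i := m)) k))"
      unfolding bessel_prod_def using that by (subst prod.remove[of _ i]) auto
    also have "(\<Prod>k\<in>{..<d} - {i}. bessel (x k) ((v(i := m)) k)) = (\<Prod>k\<in>{..<d} - {i}. bessel (x k) (v k))"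
      by (intro prod.cong) auto
    finally show ?thesis .
  qed
  show ?thesis
    unfolding bessel_prod_def[of d x v] fps_deriv_prod[OF finite_lessThan]
    by (intro sum.cong refl) (simp add: upd bessel_deriv algebra_simps)
qed

lemma bessel_prod_nth_0: "fps_nth (bessel_prod d x v) 0 = of_bool (\<forall>i<d. v i = 0)"
  unfolding bessel_prod_def
  by (induction d) (auto simp: bessel_def less_Suc_eq)

section \<open>Weighted sums over paths\<close>

text \<open>
  The expectation of \<open>f\<close> over the list of the first \<open>n\<close> steps, with the first step at the head.
\<close>

primrec path_sum :: "nat \<Rightarrow> (nat \<Rightarrow> real) \<Rightarrow> nat \<Rightarrow> ((nat \<Rightarrow> int) list \<Rightarrow> real) \<Rightarrow> real" where
  "path_sum d x 0 f = f []"
| "path_sum d x (Suc n) f = (\<Sum>i<d. x i / 2 *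
     (path_sum d x n (\<lambda>l. f (std_unit i # l)) + path_sum d x n (\<lambda>l. f (- std_unit i # l))))"

definition endpoint :: "(nat \<Rightarrow> int) list \<Rightarrow> nat \<Rightarrow> int" where
  "endpoint l = (\<lambda>j. \<Sum>v\<leftarrow>l. v j)"

lemma endpoint_Nil [simp]: "endpoint [] = zero_vector"
  by (simp add: endpoint_def zero_vector_def)

lemma endpoint_append: "endpoint (l @ l') j = endpoint l j + endpoint l' j"
  by (simp add: endpoint_def)

lemma path_sum_endpoint:
  assumes "\<And>j. d \<le> j \<Longrightarrow> v j = 0"
  shows "path_sum d x n (\<lambda>l. of_bool (endpoint l = v)) = fact n * fps_nth (bessel_prod d x v) n"
  using assms
proof (induction n arbitrary: v)
  case 0
  have "zero_vector = v \<longleftrightarrow> (\<forall>i<d. v i = 0)"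
    using 0 by (auto simp: zero_vector_def fun_eq_iff) (metis not_le)
  then show ?case by (simp add: bessel_prod_nth_0)
next
  case (Suc n)
  have plus: "endpoint (std_unit i # l) = v \<longleftrightarrow> endpoint l = v(i := v i - 1)" for i l
    by (auto simp: endpoint_def fun_eq_iff std_unit_def)
  have minus: "endpoint (- std_unit i # l) = v \<longleftrightarrow> endpoint l = v(i := v i + 1)" for i l
    by (auto simp: endpoint_def fun_eq_iff std_unit_def)
  have "path_sum d x (Suc n) (\<lambda>l. of_bool (endpoint l = v))
      = (\<Sum>i<d. x i / 2 * (fact n * fps_nth (bessel_prod d x (v(i := v i - 1))) n
          + fact n * fps_nth (bessel_prod d x (v(i := v i + 1))) n))"
    unfolding path_sum.simps plus minus
    using Suc.prems by (intro sum.cong refl arg_cong2[where f = "(*)"] arg_cong2[where f = "(+)"] Suc.IH) auto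
  also have "\<dots> = fact n * fps_nth (fps_deriv (bessel_prod d x v)) n"
    unfolding bessel_prod_deriv
    by (simp add: fps_sum_nth sum_distrib_left algebra_simps)
  also have "\<dots> = fact (Suc n) * fps_nth (bessel_prod d x v) (Suc n)"
    by simp
  finally show ?case .
qed

lemma path_sum_return:
  "path_sum d x (2 * n) (\<lambda>l. of_bool (endpoint l = zero_vector)) = return_prob d x n"
  "path_sum d x (2 * n + 1) (\<lambda>l. of_bool (endpoint l = zero_vector)) = 0"
proof -
  have "path_sum d x N (\<lambda>l. of_bool (endpoint l = zero_vector))
      = fact N * fps_nth (\<Prod>i<d. bessel (x i) 0) N" for N
    using path_sum_endpoint[of d zero_vector x N] by (simp add: zero_vector_def bessel_prod_def)
  then show "path_sum d x (2 * n) (\<lambda>l. of_bool (endpoint l = zero_vector)) = return_prob d x n"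
    "path_sum d x (2 * n + 1) (\<lambda>l. of_bool (endpoint l = zero_vector)) = 0"
    by (simp_all only: prod_bessel_0_nth) (simp_all add: return_prob_def collision_def central_fact)
qed

lemma path_sum_cong:
  "(\<And>l. length l = n \<Longrightarrow> f l = g l) \<Longrightarrow> path_sum d x n f = path_sum d x n g"
proof (induction n arbitrary: f g)
  case (Suc n)
  have "path_sum d x n (\<lambda>l. f (v # l)) = path_sum d x n (\<lambda>l. g (v # l))" for v
    by (rule Suc.IH) (simp add: Suc.prems)
  then show ?case by simp
qed simp

lemma path_sum_mono:
  assumes "\<And>i. i < d \<Longrightarrow> 0 \<le> x i" "\<And>l. length l = n \<Longrightarrow> f l \<le> g l"
  shows "path_sum d x n f \<le> path_sum d x n g"
  using assms(2)
proof (induction n arbitrary: f g)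
  case (Suc n)
  have "path_sum d x n (\<lambda>l. f (v # l)) \<le> path_sum d x n (\<lambda>l. g (v # l))" for v
    by (rule Suc.IH) (simp add: Suc.prems)
  then show ?case
    unfolding path_sum.simps by (intro sum_mono mult_left_mono add_mono) (auto simp: assms(1))
qed simp

lemma path_sum_add: "path_sum d x n (\<lambda>l. f l + g l) = path_sum d x n f + path_sum d x n g"
  by (induction n arbitrary: f g) (simp_all add: sum.distrib algebra_simps)

lemma path_sum_cmult: "path_sum d x n (\<lambda>l. c * f l) = c * path_sum d x n f"
  by (induction n arbitrary: f) (simp_all add: sum_distrib_left algebra_simps)

lemma path_sum_sum: "path_sum d x n (\<lambda>l. \<Sum>k\<in>K. f k l) = (\<Sum>k\<in>K. path_sum d x n (f k))"
proof (induction K rule: infinite_finite_induct)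
  case (insert k K)
  then show ?case by (simp add: path_sum_add)
qed (use path_sum_cmult[of d x n 0 "\<lambda>_. 0"] in simp_all)

lemma path_sum_const: "(\<Sum>i<d. x i) = 1 \<Longrightarrow> path_sum d x n (\<lambda>_. c) = c"
  by (induction n) (simp_all add: sum_distrib_right[symmetric])

lemma path_sum_append:
  "path_sum d x (m + n) (\<lambda>l. f (take m l) * g (drop m l)) = path_sum d x m f * path_sum d x n g"
proof (induction m arbitrary: f)
  case (Suc m)
  have "path_sum d x (m + n) (\<lambda>l. f (take (Suc m) (v # l)) * g (drop (Suc m) (v # l)))
      = path_sum d x m (\<lambda>l. f (v # l)) * path_sum d x n g" for v
    using Suc.IH[of "\<lambda>l. f (v # l)"] by simp
  then show ?case
    unfolding add_Suc path_sum.simps sum_distrib_right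
    by (intro sum.cong refl) (simp only: distrib_right mult.assoc)
qed (simp add: path_sum_cmult)

definition no_return :: "(nat \<Rightarrow> int) list \<Rightarrow> bool" where
  "no_return l \<longleftrightarrow> (\<forall>m\<in>{1..length l}. endpoint (take m l) \<noteq> zero_vector)"

definition survival :: "nat \<Rightarrow> (nat \<Rightarrow> real) \<Rightarrow> nat \<Rightarrow> real" where
  "survival d x n = path_sum d x n (\<lambda>l. of_bool (no_return l))"

text \<open>
  Exactly one \<open>k\<close> is the last time at the origin.
\<close>

lemma last_visit:
  assumes "length l = n"
  shows "(\<Sum>k\<le>n. of_bool (endpoint (take k l) = zero_vector) * of_bool (no_return (drop k l))) = (1 :: real)"
proof -
  define Z where "Z = {k. k \<le> n \<and> endpoint (take k l) = zero_vector}"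
  have Z: "finite Z" "0 \<in> Z" by (auto simp: Z_def)
  define K where "K = Max Z"
  have K: "K \<in> Z" unfolding K_def using Z by (intro Max_in) auto
  have iff: "no_return (drop k l) \<longleftrightarrow> k = K" if "k \<in> Z" for k
  proof -
    have k: "k \<le> n" "endpoint (take k l) = zero_vector" using that by (auto simp: Z_def)
    have "endpoint (take m (drop k l)) = endpoint (take (k + m) l)" for m
    proof
      fix j
      have "endpoint (take (k + m) l) j = endpoint (take k l) j + endpoint (take m (drop k l)) j"
        by (simp add: take_add endpoint_append)
      then show "endpoint (take m (drop k l)) j = endpoint (take (k + m) l) j"
        using k by (simp add: zero_vector_def)
    qed
    then have "no_return (drop k l) \<longleftrightarrow> (\<forall>m\<in>{1..n - k}. k + m \<notin> Z)"
      using assms k by (auto simp: no_return_def Z_def)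
    also have "\<dots> \<longleftrightarrow> (\<forall>m\<in>Z. m \<le> k)"
    proof (intro iffI ballI)
      fix m assume *: "\<forall>m\<in>{1..n - k}. k + m \<notin> Z" "m \<in> Z"
      show "m \<le> k"
      proof (rule ccontr)
        assume "\<not> m \<le> k"
        then have "m - k \<in> {1..n - k}" "k + (m - k) = m" using *(2) by (auto simp: Z_def)
        with * show False by metis
      qed
    qed force
    also have "\<dots> \<longleftrightarrow> k = K"
      using Z(1) that K unfolding K_def by (metis Max_ge Max_eqI)
    finally show ?thesis .
  qed
  have "(\<Sum>k\<le>n. of_bool (endpoint (take k l) = zero_vector) * of_bool (no_return (drop k l)))
      = (\<Sum>k\<le>n. if k = K then 1 else 0 :: real)"
  proof (intro sum.cong refl)
    fix k assume "k \<in> {..n}"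
    show "of_bool (endpoint (take k l) = zero_vector) * of_bool (no_return (drop k l))
        = (if k = K then 1 else 0 :: real)"
      using iff[of k] K \<open>k \<in> {..n}\<close> by (cases "k \<in> Z") (auto simp: Z_def)
  qed
  also have "\<dots> = 1" using K by (simp add: Z_def)
  finally show ?thesis .
qed

lemma survival_renewal:
  assumes x: "(\<Sum>i<d. x i) = 1"
  shows "(\<Sum>k\<le>n. path_sum d x k (\<lambda>l. of_bool (endpoint l = zero_vector)) * survival d x (n - k)) = 1"
proof -
  have "(\<Sum>k\<le>n. path_sum d x k (\<lambda>l. of_bool (endpoint l = zero_vector)) * survival d x (n - k))
      = (\<Sum>k\<le>n. path_sum d x n (\<lambda>l. of_bool (endpoint (take k l) = zero_vector) * of_bool (no_return (drop k l))))"
    unfolding survival_def by (intro sum.cong refl) (simp add: path_sum_append[symmetric])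
  also have "\<dots> = path_sum d x n (\<lambda>l. 1)"
    unfolding path_sum_sum[symmetric] by (intro path_sum_cong last_visit)
  also have "\<dots> = 1" using x by (rule path_sum_const)
  finally show ?thesis .
qed

lemma survival_Suc:
  assumes x: "(\<Sum>i<d. x i) = 1" "\<And>i. i < d \<Longrightarrow> 0 \<le> x i"
  shows "survival d x (Suc n) \<le> survival d x n"
    and "survival d x n \<le> survival d x (Suc n) + path_sum d x (Suc n) (\<lambda>l. of_bool (endpoint l = zero_vector))"
proof -
  have eq: "survival d x n = path_sum d x (Suc n) (\<lambda>l. of_bool (no_return (take n l)))"
    using path_sum_append[of d x n 1 "\<lambda>l. of_bool (no_return l)" "\<lambda>_. 1"]
    unfolding path_sum_const[OF x(1)] survival_def by (simp only: Suc_eq_plus1 mult_1_right)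
  show "survival d x (Suc n) \<le> survival d x n"
    unfolding eq unfolding survival_def
    by (intro path_sum_mono x) (auto simp: no_return_def min_def)
  show "survival d x n \<le> survival d x (Suc n) + path_sum d x (Suc n) (\<lambda>l. of_bool (endpoint l = zero_vector))"
    unfolding eq unfolding survival_def path_sum_add[symmetric]
  proof (intro path_sum_mono x)
    fix l :: "(nat \<Rightarrow> int) list" assume l: "length l = Suc n"
    have "no_return l \<or> endpoint l = zero_vector" if "no_return (take n l)"
      using that l by (auto simp: no_return_def min_def)
    then show "of_bool (no_return (take n l)) \<le> of_bool (no_return l) + (of_bool (endpoint l = zero_vector) :: real)"
      by auto
  qed
qed

lemma survival_odd:
  assumes "(\<Sum>i<d. x i) = 1" "\<And>i. i < d \<Longrightarrow> 0 \<le> x i"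
  shows "survival d x (2 * n + 1) = survival d x (2 * n)"
  using survival_Suc[OF assms, of "2 * n"] path_sum_return(2)[of d x n] by simp

lemma sum_even:
  fixes f :: "nat \<Rightarrow> real"
  assumes "\<And>k. f (2 * k + 1) = 0"
  shows "(\<Sum>k\<le>2 * n. f k) = (\<Sum>k\<le>n. f (2 * k))"
  using assms by (induction n) (auto simp: add.commute)

lemma return_prob_renewal:
  assumes x: "(\<Sum>i<d. x i) = 1" "\<And>i. i < d \<Longrightarrow> 0 \<le> x i"
  shows "renewal (return_prob d x) (\<lambda>n. survival d x (2 * n))"
  unfolding renewal_def
proof (intro conjI allI)
  show "return_prob d x 0 = 1" by (simp add: return_prob_def collision_def)
  show "0 \<le> return_prob d x n" for n using return_prob_pos[OF x] by (simp add: less_imp_le)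
  show "0 \<le> survival d x (2 * n)" for n
    using path_sum_mono[of d x "2 * n" "\<lambda>_. 0"] x path_sum_const[OF x(1), of "2 * n" 0] by (auto simp: survival_def)
  have "decseq (survival d x)"
    using survival_Suc(1)[OF x] by (intro decseq_SucI)
  then show "decseq (\<lambda>n. survival d x (2 * n))"
    by (auto simp: decseq_def)
  fix n
  define f where "f k = path_sum d x k (\<lambda>l. of_bool (endpoint l = zero_vector)) * survival d x (2 * n - k)" for k
  have "(\<Sum>k\<le>n. return_prob d x k * survival d x (2 * (n - k))) = (\<Sum>k\<le>n. f (2 * k))"
    by (simp add: f_def path_sum_return diff_mult_distrib2)
  also have "\<dots> = (\<Sum>k\<le>2 * n. f k)"
    using path_sum_return(2)[of d x] by (intro sum_even[symmetric]) (simp add: f_def)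
  also have "\<dots> = 1"
    unfolding f_def by (rule survival_renewal[OF x(1)])
  finally show "(\<Sum>k\<le>n. return_prob d x k * survival d x (2 * (n - k))) = 1" .
qed

section \<open>The random walk and its paths\<close>

definition unit_steps :: "nat \<Rightarrow> (nat \<Rightarrow> int) set" where
  "unit_steps d = std_unit ` {..<d} \<union> (\<lambda>i. - std_unit i) ` {..<d}"

lemma sum_unit_steps:
  "(\<Sum>v\<in>unit_steps d. f v) = (\<Sum>i<d. f (std_unit i) + (f (- std_unit i) :: real))"
proof -
  have val: "std_unit i j = (if j = i then 1 else 0)" for i j
    by (simp add: std_unit_def)
  have eq: "std_unit i = std_unit j \<longleftrightarrow> i = j" for i j
    by (metis val zero_neq_one)
  have "std_unit i \<noteq> - std_unit j" for i j
  proof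
    assume "std_unit i = - std_unit j"
    then have "std_unit i i = - std_unit j i" by simp
    then show False by (simp add: val split: if_splits)
  qed
  then have disj: "std_unit ` {..<d} \<inter> (\<lambda>i. - std_unit i) ` {..<d} = {}" by auto
  have "inj_on std_unit {..<d}" "inj_on (\<lambda>i. - std_unit i) {..<d}"
    by (auto simp: inj_on_def eq fun_eq_iff) (auto simp: val split: if_splits)
  then show ?thesis
    unfolding unit_steps_def by (simp add: sum.union_disjoint[OF _ _ disj] sum.reindex sum.distrib)
qed

lemma finite_unit_steps [simp]: "finite (unit_steps d)"
  by (simp add: unit_steps_def)

definition step_lists :: "nat \<Rightarrow> nat \<Rightarrow> (nat \<Rightarrow> int) list set" where
  "step_lists d n = {l. set l \<subseteq> unit_steps d \<and> length l = n}"

lemma finite_step_lists [simp]: "finite (step_lists d n)"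
  unfolding step_lists_def by (rule finite_lists_length_eq) simp

lemma sum_step_lists:
  assumes "\<And>i. i < d \<Longrightarrow> w (std_unit i) = x i / 2" "\<And>i. i < d \<Longrightarrow> w (- std_unit i) = x i / 2"
  shows "(\<Sum>l\<in>step_lists d n. (\<Prod>v\<leftarrow>l. w v) * f l) = path_sum d x n f"
proof (induction n arbitrary: f)
  case 0
  have "step_lists d 0 = {[]}" by (auto simp: step_lists_def)
  then show ?case by simp
next
  case (Suc n)
  have "step_lists d (Suc n) = (\<lambda>(l, v). v # l) ` (step_lists d n \<times> unit_steps d)"
    unfolding step_lists_def by (rule lists_length_Suc_eq)
  moreover have "inj_on (\<lambda>(l, v). v # l) (step_lists d n \<times> unit_steps d)"
    by (auto simp: inj_on_def)
  ultimately have "(\<Sum>l\<in>step_lists d (Suc n). (\<Prod>v\<leftarrow>l. w v) * f l)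
      = (\<Sum>(l, v)\<in>step_lists d n \<times> unit_steps d. w v * (\<Prod>v\<leftarrow>l. w v) * f (v # l))"
    by (simp add: sum.reindex case_prod_unfold)
  also have "\<dots> = (\<Sum>v\<in>unit_steps d. \<Sum>l\<in>step_lists d n. w v * (\<Prod>v\<leftarrow>l. w v) * f (v # l))"
    by (subst sum.swap) (simp add: sum.cartesian_product)
  also have "\<dots> = (\<Sum>v\<in>unit_steps d. w v * path_sum d x n (\<lambda>l. f (v # l)))"
    by (simp add: Suc.IH[symmetric] sum_distrib_left mult.assoc)
  also have "\<dots> = path_sum d x (Suc n) f"
    unfolding sum_unit_steps path_sum.simps using assms
    by (intro sum.cong refl) (simp only: assms distrib_left lessThan_iff)
  finally show ?case .
qed

definition step_path :: "(nat \<Rightarrow> 'a \<Rightarrow> nat \<Rightarrow> int) \<Rightarrow> nat \<Rightarrow> 'a \<Rightarrow> (nat \<Rightarrow> int) list" where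
  "step_path X n \<omega> = map (\<lambda>k. X (Suc k) \<omega>) [0..<n]"

lemma length_step_path [simp]: "length (step_path X n \<omega>) = n"
  by (simp add: step_path_def)

lemma walk_step_path: "m \<le> n \<Longrightarrow> walk X m \<omega> = endpoint (take m (step_path X n \<omega>))"
  by (simp add: walk_def endpoint_def step_path_def take_map take_upt interv_sum_list_conv_sum_set_nat
      sum.atLeast1_atMost_eq atLeast0LessThan comp_def)

lemma step_path_eq_iff: "length l = n \<Longrightarrow> step_path X n \<omega> = l \<longleftrightarrow> (\<forall>k\<in>{1..n}. X k \<omega> = l ! (k - 1))"
proof -
  assume l: "length l = n"
  have "step_path X n \<omega> = l \<longleftrightarrow> (\<forall>k<n. X (Suc k) \<omega> = l ! k)"
    using l by (auto simp: list_eq_iff_nth_eq step_path_def)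
  also have "\<dots> \<longleftrightarrow> (\<forall>k\<in>{1..n}. X k \<omega> = l ! (k - 1))"
  proof (intro iffI ballI allI impI)
    fix k assume "\<forall>k<n. X (Suc k) \<omega> = l ! k" "k \<in> {1..n}"
    then show "X k \<omega> = l ! (k - 1)" by (cases k) auto
  next
    fix k assume *: "\<forall>k\<in>{1..n}. X k \<omega> = l ! (k - 1)" "k < n"
    then have "Suc k \<in> {1..n}" by simp
    with *(1) have "X (Suc k) \<omega> = l ! (Suc k - 1)" by blast
    then show "X (Suc k) \<omega> = l ! k" by simp
  qed
  finally show ?thesis .
qed

lemma return_time_le_iff: "return_time X \<omega> \<le> enat n \<longleftrightarrow> (\<exists>m\<in>{1..n}. walk X m \<omega> = zero_vector)"
proof -
  define S where "S = {enat m | m. 1 \<le> m \<and> walk X m \<omega> = zero_vector}"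
  have "Inf S \<le> enat n \<longleftrightarrow> (\<exists>s\<in>S. s \<le> enat n)"
  proof
    assume le: "Inf S \<le> enat n"
    have "S \<noteq> {}"
    proof
      assume "S = {}"
      with le show False by (simp add: Inf_enat_def)
    qed
    then have "Inf S \<in> S" by (auto intro: wellorder_InfI)
    with le show "\<exists>s\<in>S. s \<le> enat n" by blast
  qed (auto intro: Inf_lower2)
  moreover have "S = enat ` {m. 1 \<le> m \<and> walk X m \<omega> = zero_vector}"
    by (auto simp: S_def)
  ultimately show ?thesis
    unfolding return_time_def S_def[symmetric] by auto
qed

lemma return_time_finite_iff: "return_time X \<omega> < \<infinity> \<longleftrightarrow> (\<exists>n. return_time X \<omega> \<le> enat n)"
  by (cases "return_time X \<omega>") auto

context random_walk
begin

lemma X_measurable: "1 \<le> k \<Longrightarrow> X k \<in> measurable M (count_space (lattice_Z d))"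
  using indep by (auto simp: indep_vars_def)

lemma walk_zero_measurable: "{\<omega> \<in> space M. walk X n \<omega> = zero_vector} \<in> sets M"
proof -
  have lat: "X k \<omega> j = 0" if "\<omega> \<in> space M" "1 \<le> k" "d \<le> j" for k j \<omega>
    using measurable_space[OF X_measurable[OF that(2)] that(1)] that(3) by (auto simp: lattice_Z_def)
  have "{\<omega> \<in> space M. walk X n \<omega> = zero_vector}
      = {\<omega> \<in> space M. \<forall>j\<in>{..<d}. (\<Sum>k=1..n. real_of_int (X k \<omega> j)) = 0}"
  proof (intro Collect_cong conj_cong refl)
    fix \<omega> assume \<omega>: "\<omega> \<in> space M"
    have "walk X n \<omega> = zero_vector \<longleftrightarrow> (\<forall>j. (\<Sum>k=1..n. X k \<omega> j) = 0)"
      by (simp add: walk_def zero_vector_def fun_eq_iff)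
    also have "\<dots> \<longleftrightarrow> (\<forall>j\<in>{..<d}. (\<Sum>k=1..n. X k \<omega> j) = 0)"
    proof (intro iffI allI ballI)
      fix j assume *: "\<forall>j\<in>{..<d}. (\<Sum>k=1..n. X k \<omega> j) = 0"
      show "(\<Sum>k=1..n. X k \<omega> j) = 0"
      proof (cases "j < d")
        case False
        then show ?thesis using lat[OF \<omega>] by (intro sum.neutral) auto
      qed (use * in auto)
    qed auto
    also have "\<dots> \<longleftrightarrow> (\<forall>j\<in>{..<d}. (\<Sum>k=1..n. real_of_int (X k \<omega> j)) = 0)"
      by (simp only: of_int_sum[symmetric] of_int_eq_0_iff)
    finally show "walk X n \<omega> = zero_vector \<longleftrightarrow> (\<forall>j\<in>{..<d}. (\<Sum>k=1..n. real_of_int (X k \<omega> j)) = 0)" .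
  qed
  also have "\<dots> \<in> sets M"
  proof -
    have [measurable]: "(\<lambda>\<omega>. real_of_int (X k \<omega> j)) \<in> borel_measurable M" if "k \<in> {1..n}" for k j
      using that by (intro measurable_compose[OF X_measurable]) auto
    show ?thesis by measurable
  qed
  finally show ?thesis .
qed

lemma return_time_measurable: "{\<omega> \<in> space M. return_time X \<omega> \<le> enat n} \<in> sets M"
proof -
  have "{\<omega> \<in> space M. return_time X \<omega> \<le> enat n} = (\<Union>m\<in>{1..n}. {\<omega> \<in> space M. walk X m \<omega> = zero_vector})"
    by (auto simp: return_time_le_iff)
  also have "\<dots> \<in> sets M" by (intro sets.finite_UN walk_zero_measurable) auto
  finally show ?thesis .
qed

text \<open>
  Almost every path has steps in \<open>unit_steps d\<close>, because the probabilities of the lists of unit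
  steps add up to 1. So an event that depends on the first \<open>n\<close> steps is, up to a null set, a
  finite union of events that prescribe these steps, whose probabilities are products by independence.
\<close>

lemma prob_step_path:
  assumes h: "prob_vector d h"
    and Q: "{\<omega> \<in> space M. Q \<omega>} \<in> sets M" "\<And>\<omega>. \<omega> \<in> space M \<Longrightarrow> Q \<omega> \<longleftrightarrow> A (step_path X n \<omega>)"
  shows "\<P>(\<omega> in M. Q \<omega>) = path_sum d ((!) h) n (\<lambda>l. of_bool (A l))"
proof -
  define w where "w v = \<P>(\<omega> in M. X 1 \<omega> = v)" for v
  have w: "w (std_unit i) = h ! i / 2" "w (- std_unit i) = h ! i / 2" if "i < d" for i
    using that step_pos step_neg by (auto simp: w_def)
  have law: "\<P>(\<omega> in M. X k \<omega> = v) = w v" if "1 \<le> k" "v \<in> unit_steps d" for k v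
  proof -
    from that(2) obtain i where "i < d" "v = std_unit i \<or> v = - std_unit i"
      by (auto simp: unit_steps_def)
    then show ?thesis
      using step_pos[OF that(1), of i] step_neg[OF that(1), of i] w[of i] by auto
  qed
  have lattice: "unit_steps d \<subseteq> lattice_Z d"
    by (auto simp: unit_steps_def lattice_Z_def std_unit_def)
  define F where "F l = {\<omega> \<in> space M. step_path X n \<omega> = l}" for l
  have F: "F l \<in> sets M \<and> prob (F l) = (\<Prod>v\<leftarrow>l. w v)" if l: "l \<in> step_lists d n" for l
  proof (cases "n = 0")
    case True
    then have "F l = space M" using l by (auto simp: F_def step_lists_def step_path_def)
    then show ?thesis using True l by (simp add: prob_space step_lists_def)
  next
    case False
    have len: "length l = n" using l by (simp add: step_lists_def)
    have mem: "l ! (k - 1) \<in> unit_steps d" if "k \<in> {1..n}" for k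
    proof -
      have "l ! (k - 1) \<in> set l" using that len by (intro nth_mem) auto
      then show ?thesis using l by (auto simp: step_lists_def)
    qed
    have F_eq: "F l = (\<Inter>k\<in>{1..n}. X k -` {l ! (k - 1)} \<inter> space M)"
      using False by (auto simp: F_def step_path_eq_iff[OF len])
    have "F l \<in> sets M"
      unfolding F_eq
    proof (intro sets.finite_INT)
      fix k assume k: "k \<in> {1..n}"
      show "X k -` {l ! (k - 1)} \<inter> space M \<in> sets M"
        using k mem[OF k] lattice by (intro measurable_sets[OF X_measurable]) auto
    qed (use False in auto)
    have "prob (F l) = (\<Prod>k\<in>{1..n}. prob (X k -` {l ! (k - 1)} \<inter> space M))"
      unfolding F_eq
    proof (rule indep_varsD[OF indep])
      show "{l ! (k - 1)} \<in> sets (count_space (lattice_Z d))" if "k \<in> {1..n}" for k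
        using mem[OF that] lattice by auto
    qed (use False in auto)
    also have "\<dots> = (\<Prod>k\<in>{1..n}. w (l ! (k - 1)))"
    proof (intro prod.cong refl)
      fix k assume k: "k \<in> {1..n}"
      have "X k -` {l ! (k - 1)} \<inter> space M = {\<omega> \<in> space M. X k \<omega> = l ! (k - 1)}" by auto
      then show "prob (X k -` {l ! (k - 1)} \<inter> space M) = w (l ! (k - 1))"
        using law[of k "l ! (k - 1)"] mem[OF k] k by simp
    qed
    also have "\<dots> = (\<Prod>k\<in>{0..<n}. w (l ! k))"
      by (rule prod.reindex_bij_witness[where i = Suc and j = "\<lambda>k. k - 1"]) auto
    also have "\<dots> = (\<Prod>v\<leftarrow>l. w v)"
      by (simp add: prod.list_conv_set_nth len)
    finally have "prob (F l) = (\<Prod>v\<leftarrow>l. w v)" .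
    with \<open>F l \<in> sets M\<close> show ?thesis by simp
  qed
  have total: "(\<Sum>i<d. h ! i) = 1" using h by (simp add: prob_vector_def)
  have "disjoint_family_on F (step_lists d n)" by (auto simp: disjoint_family_on_def F_def)
  have union: "prob (\<Union>l\<in>L. F l) = (\<Sum>l\<in>step_lists d n. (\<Prod>v\<leftarrow>l. w v) * of_bool (l \<in> L))"
    if "L \<subseteq> step_lists d n" for L
  proof -
    have "finite L" using that by (rule finite_subset) simp
    then have "prob (\<Union>l\<in>L. F l) = (\<Sum>l\<in>L. prob (F l))"
      using F that by (intro finite_measure_finite_Union) (auto simp: disjoint_family_on_def F_def)
    also have "\<dots> = (\<Sum>l\<in>step_lists d n. (\<Prod>v\<leftarrow>l. w v) * of_bool (l \<in> L))"
      using F that by (intro sum.mono_neutral_cong_left) auto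
    finally show ?thesis .
  qed
  have union_sets: "(\<Union>l\<in>L. F l) \<in> sets M" if "L \<subseteq> step_lists d n" for L
    using F that by (intro sets.finite_UN) (auto intro: finite_subset)
  define L where "L = {l \<in> step_lists d n. A l}"
  have "prob (\<Union>l\<in>step_lists d n. F l) = path_sum d ((!) h) n (\<lambda>_. 1)"
    using union[of "step_lists d n"] sum_step_lists[where w = w and x = "(!) h" and n = n and f = "\<lambda>_. 1", OF w] by simp
  then have "prob (\<Union>l\<in>step_lists d n. F l) = 1"
    using path_sum_const[OF total] by simp
  then have "AE \<omega> in M. \<omega> \<in> (\<Union>l\<in>step_lists d n. F l)"
    using union_sets by (subst prob_eq_1[symmetric]) auto
  then have "AE \<omega> in M. \<omega> \<in> {\<omega> \<in> space M. Q \<omega>} \<longleftrightarrow> \<omega> \<in> (\<Union>l\<in>L. F l)"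
    by eventually_elim (auto simp: F_def L_def Q(2))
  then have "\<P>(\<omega> in M. Q \<omega>) = prob (\<Union>l\<in>L. F l)"
    using Q(1) union_sets[of L] by (intro finite_measure_eq_AE) (auto simp: L_def)
  also have "\<dots> = path_sum d ((!) h) n (\<lambda>l. of_bool (A l))"
  proof -
    have "(\<Sum>l\<in>step_lists d n. (\<Prod>v\<leftarrow>l. w v) * of_bool (l \<in> L))
        = (\<Sum>l\<in>step_lists d n. (\<Prod>v\<leftarrow>l. w v) * of_bool (A l))"
      by (intro sum.cong) (auto simp: L_def)
    then show ?thesis
      using union[of L] sum_step_lists[where w = w and x = "(!) h" and n = n and f = "\<lambda>l. of_bool (A l)", OF w]
      by (simp add: L_def)
  qed
  finally show ?thesis .
qed

lemma prob_walk_zero: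
  assumes "prob_vector d h"
  shows "\<P>(\<omega> in M. walk X (2 * n) \<omega> = zero_vector) = return_prob d ((!) h) n"
proof -
  have "\<P>(\<omega> in M. walk X (2 * n) \<omega> = zero_vector)
      = path_sum d ((!) h) (2 * n) (\<lambda>l. of_bool (endpoint l = zero_vector))"
    by (rule prob_step_path[OF assms walk_zero_measurable]) (simp add: walk_step_path[of "2 * n" "2 * n"])
  then show ?thesis by (simp only: path_sum_return)
qed

lemma prob_return_time_le:
  assumes "prob_vector d h"
  shows "\<P>(\<omega> in M. return_time X \<omega> \<le> enat n) = 1 - survival d ((!) h) n"
proof -
  have total: "(\<Sum>i<d. h ! i) = 1" using assms by (simp add: prob_vector_def)
  have "\<P>(\<omega> in M. return_time X \<omega> \<le> enat n) = path_sum d ((!) h) n (\<lambda>l. of_bool (\<not> no_return l))"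
  proof (rule prob_step_path[OF assms return_time_measurable])
    fix \<omega>
    show "return_time X \<omega> \<le> enat n \<longleftrightarrow> \<not> no_return (step_path X n \<omega>)"
      using walk_step_path[of _ n X \<omega>] by (auto simp: return_time_le_iff no_return_def)
  qed
  moreover have "path_sum d ((!) h) n (\<lambda>l. of_bool (\<not> no_return l) + of_bool (no_return l)) = 1"
    using path_sum_const[OF total, of n 1] path_sum_cong[of n "\<lambda>l. of_bool (\<not> no_return l) + of_bool (no_return l)" "\<lambda>_. 1" d "(!) h"]
    by simp
  ultimately show ?thesis
    unfolding path_sum_add survival_def by simp
qed

lemma prob_return_time_le_LIMSEQ:
  "(\<lambda>n. \<P>(\<omega> in M. return_time X \<omega> \<le> enat n)) \<longlonglongrightarrow> \<P>(\<omega> in M. return_time X \<omega> < \<infinity>)"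
proof -
  have "{\<omega> \<in> space M. return_time X \<omega> < \<infinity>} = (\<Union>n. {\<omega> \<in> space M. return_time X \<omega> \<le> enat n})"
    using return_time_finite_iff[of X] by blast
  moreover have "incseq (\<lambda>n. {\<omega> \<in> space M. return_time X \<omega> \<le> enat n})"
    by (auto simp: incseq_def intro: order_trans)
  ultimately show ?thesis
    using finite_Lim_measure_incseq[of "\<lambda>n. {\<omega> \<in> space M. return_time X \<omega> \<le> enat n}"]
      return_time_measurable by auto
qed

lemma survival_LIMSEQ:
  assumes "prob_vector d h"
  shows "(\<lambda>n. survival d ((!) h) (2 * n)) \<longlonglongrightarrow> 1 - \<P>(\<omega> in M. return_time X \<omega> < \<infinity>)"
proof -
  have "(\<lambda>n. 1 - \<P>(\<omega> in M. return_time X \<omega> \<le> enat n)) \<longlonglongrightarrow> 1 - \<P>(\<omega> in M. return_time X \<omega> < \<infinity>)"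
    by (intro tendsto_intros prob_return_time_le_LIMSEQ)
  then have "survival d ((!) h) \<longlonglongrightarrow> 1 - \<P>(\<omega> in M. return_time X \<omega> < \<infinity>)"
    by (simp add: prob_return_time_le[OF assms])
  moreover have "strict_mono (\<lambda>n :: nat. 2 * n)" by (simp add: strict_mono_def)
  ultimately show ?thesis
    by (rule LIMSEQ_subseq_LIMSEQ[unfolded comp_def])
qed

end

section \<open>Comparison of two walks\<close>

text \<open>
  The walks may have different dimensions: only their return probabilities enter. At odd times
  nothing changes, so the order at even times suffices.
\<close>

lemma strict_stoch_order:
  assumes X: "random_walk d h M X" "prob_vector d h"
    and Y: "random_walk e k N Y" "prob_vector e k"
    and le: "\<And>n. return_prob e ((!) k) n \<le> return_prob d ((!) h) n"
    and less: "return_prob e ((!) k) 1 < return_prob d ((!) h) 1"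
  shows "\<P>(\<omega> in N. return_time Y \<omega> < \<infinity>) \<le> \<P>(\<omega> in M. return_time X \<omega> < \<infinity>)"
    and "\<P>(\<omega> in N. return_time Y \<omega> \<le> 2) < \<P>(\<omega> in M. return_time X \<omega> \<le> 2)"
    and "strictly_stoch_smaller M (return_time X) N (return_time Y)"
proof -
  interpret X: random_walk d h M X by fact
  interpret Y: random_walk e k N Y by fact
  have h: "(\<Sum>i<d. h ! i) = 1" "\<And>i. i < d \<Longrightarrow> 0 \<le> h ! i"
    and k: "(\<Sum>i<e. k ! i) = 1" "\<And>i. i < e \<Longrightarrow> 0 \<le> k ! i"
    using X(2) Y(2) by (auto simp: prob_vector_def)
  have renX: "renewal (return_prob d ((!) h)) (\<lambda>n. survival d ((!) h) (2 * n))" by (rule return_prob_renewal[OF h])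
  have renY: "renewal (return_prob e ((!) k)) (\<lambda>n. survival e ((!) k) (2 * n))" by (rule return_prob_renewal[OF k])
  have even: "survival d ((!) h) (2 * n) \<le> survival e ((!) k) (2 * n)" for n
    by (rule renewal_mono[OF renX return_prob_def collision_type_series_decseq[OF h] _ renY return_prob_def collision_type_series_decseq[OF k] _ le])
      (use h k in \<open>auto intro: collision_type_series_pos\<close>)
  have mono: "survival d ((!) h) n \<le> survival e ((!) k) n" for n
  proof (cases "even n")
    case True
    then show ?thesis using even by (elim evenE) simp
  next
    case False
    then show ?thesis
      using even survival_odd[OF h] survival_odd[OF k] by (elim oddE) simp
  qed
  then have order: "\<P>(\<omega> in N. return_time Y \<omega> \<le> enat n) \<le> \<P>(\<omega> in M. return_time X \<omega> \<le> enat n)" for n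
    using X.prob_return_time_le[OF X(2)] Y.prob_return_time_le[OF Y(2)] by simp
  show "\<P>(\<omega> in N. return_time Y \<omega> < \<infinity>) \<le> \<P>(\<omega> in M. return_time X \<omega> < \<infinity>)"
    using order by (intro LIMSEQ_le[OF Y.prob_return_time_le_LIMSEQ X.prob_return_time_le_LIMSEQ]) auto
  have survival_one: "g 1 = 1 - u 1" if "renewal u g" for u g
  proof -
    have "u 0 = 1" "(\<Sum>j\<le>0. u j * g (0 - j)) = 1" "(\<Sum>j\<le>Suc 0. u j * g (Suc 0 - j)) = 1"
      using that unfolding renewal_def by blast+
    then show ?thesis by simp
  qed
  have two: "\<P>(\<omega> in N. return_time Y \<omega> \<le> enat 2) < \<P>(\<omega> in M. return_time X \<omega> \<le> enat 2)"
    using X.prob_return_time_le[OF X(2), of 2] Y.prob_return_time_le[OF Y(2), of 2] less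
      survival_one[OF renX] survival_one[OF renY] by simp
  then show "\<P>(\<omega> in N. return_time Y \<omega> \<le> 2) < \<P>(\<omega> in M. return_time X \<omega> \<le> 2)"
    by (simp add: numeral_eq_enat)
  show "strictly_stoch_smaller M (return_time X) N (return_time Y)"
    unfolding strictly_stoch_smaller_def stoch_smaller_def
    using order two by (auto intro!: exI[of _ 2])
qed

lemma (in random_walk) recurrent:
  assumes h: "prob_vector d h" and few: "num_nonzero h < 3"
  shows "\<P>(\<omega> in M. return_time X \<omega> < \<infinity>) = 1"
proof -
  have x: "(\<Sum>i<d. h ! i) = 1" "\<And>i. i < d \<Longrightarrow> 0 \<le> h ! i" "length h = d"
    using h by (auto simp: prob_vector_def)
  have "\<not> summable (return_prob d ((!) h))"
    using x few by (intro not_summable_return_prob) (auto simp: num_nonzero_def)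
  then show ?thesis
    using renewal_recurrent[OF return_prob_renewal[OF x(1,2)] survival_LIMSEQ[OF h]] by simp
qed

lemma (in random_walk) expected_returns_eq:
  assumes "prob_vector d h"
  shows "expected_returns M X = (\<Sum>n. ennreal (return_prob d ((!) h) (Suc n)))"
  unfolding expected_returns_def prob_walk_zero[OF assms] ..

lemma suminf_strict_mono:
  fixes u v :: "nat \<Rightarrow> real"
  assumes "summable v" "\<And>n. 0 \<le> v n" "\<And>n. v n \<le> u n" "v 0 < u 0"
  shows "(\<Sum>n. ennreal (v n)) < (\<Sum>n. ennreal (u n))"
proof -
  have nn: "0 \<le> u n" for n using assms(2,3) order_trans by blast
  have "(\<Sum>n. ennreal (v n)) = ennreal (\<Sum>n. v n)"
    using assms(1,2) by (intro suminf_ennreal2)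
  also have "\<dots> < ennreal ((\<Sum>n. v n) + (u 0 - v 0))"
    using assms by (intro ennreal_lessI) (auto intro!: add_nonneg_pos suminf_nonneg)
  also have "(\<Sum>n. v n) + (u 0 - v 0) = (\<Sum>n. if n = 0 then u 0 else v n)"
  proof -
    have "(\<lambda>n. if n = 0 then u 0 - v 0 else 0) sums (u 0 - v 0)"
      using sums_single[of 0 "\<lambda>_. u 0 - v 0"] by simp
    from sums_add[OF summable_sums[OF assms(1)] this] show ?thesis
      by (intro sums_unique) (auto elim!: sums_cong[THEN iffD1, rotated])
  qed
  also have "ennreal \<dots> = (\<Sum>n. ennreal (if n = 0 then u 0 else v n))"
  proof (rule suminf_ennreal2[symmetric])
    have "summable (\<lambda>n. if n = 0 then u 0 - v 0 else 0)"
      by (rule summable_finite[of "{0}"]) auto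
    from summable_add[OF assms(1) this] show "summable (\<lambda>n. if n = 0 then u 0 else v n)"
      by (rule summable_cong[THEN iffD1, rotated]) auto
  qed (use assms nn in auto)
  also have "\<dots> \<le> (\<Sum>n. ennreal (u n))"
    by (intro suminf_le) (auto simp: assms intro: ennreal_leI)
  finally show ?thesis .
qed

text \<open>
  The probability \<open>p\<close> of never returning times any partial sum of \<open>u\<close> is at most 1, also when the
  series diverges. The finite number \<open>S + (u 1 - v 1)\<close>, where \<open>S\<close> is the sum of \<open>v\<close>, is at most the
  supremum of these partial sums, so the recurrent and the transient case need no distinction.
\<close>

lemma transient_strict:
  assumes X: "random_walk d h M X" "prob_vector d h"
    and Y: "random_walk e k N Y" "prob_vector e k"
    and le: "\<And>n. return_prob e ((!) k) n \<le> return_prob d ((!) h) n"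
    and less: "return_prob e ((!) k) 1 < return_prob d ((!) h) 1"
    and many: "3 \<le> num_nonzero k"
  shows "expected_returns N Y < \<infinity>"
    and "expected_returns N Y < expected_returns M X"
    and "\<P>(\<omega> in N. return_time Y \<omega> < \<infinity>) < \<P>(\<omega> in M. return_time X \<omega> < \<infinity>)"
proof -
  interpret X: random_walk d h M X by fact
  interpret Y: random_walk e k N Y by fact
  define u v where "u = return_prob d ((!) h)" and "v = return_prob e ((!) k)"
  have h: "(\<Sum>i<d. h ! i) = 1" "\<And>i. i < d \<Longrightarrow> 0 \<le> h ! i"
    and k: "(\<Sum>i<e. k ! i) = 1" "\<And>i. i < e \<Longrightarrow> 0 \<le> k ! i" "length k = e"
    using X(2) Y(2) by (auto simp: prob_vector_def)
  have sv: "summable v"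
    unfolding v_def using k many by (intro summable_return_prob) (auto simp: num_nonzero_def)
  then have sv': "summable (\<lambda>n. v (Suc n))" by (subst summable_Suc_iff)
  have nn: "0 < v n" for n unfolding v_def by (rule return_prob_pos[OF k(1,2)])
  have retsX: "expected_returns M X = (\<Sum>n. ennreal (u (Suc n)))"
    and retsY: "expected_returns N Y = (\<Sum>n. ennreal (v (Suc n)))"
    using X.expected_returns_eq[OF X(2)] Y.expected_returns_eq[OF Y(2)] by (simp_all add: u_def v_def)
  show "expected_returns N Y < \<infinity>"
    unfolding retsY using sv' nn by (subst suminf_ennreal2) (auto intro: less_imp_le)
  show "expected_returns N Y < expected_returns M X"
    unfolding retsX retsY
    using sv' nn le less by (intro suminf_strict_mono) (auto simp: u_def v_def less_imp_le)
  define p q where "p = 1 - \<P>(\<omega> in M. return_time X \<omega> < \<infinity>)"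
    and "q = 1 - \<P>(\<omega> in N. return_time Y \<omega> < \<infinity>)"
  have renX: "renewal u (\<lambda>n. survival d ((!) h) (2 * n))" unfolding u_def by (rule return_prob_renewal[OF h])
  have renY: "renewal v (\<lambda>n. survival e ((!) k) (2 * n))" unfolding v_def by (rule return_prob_renewal[OF k(1,2)])
  have limX: "(\<lambda>n. survival d ((!) h) (2 * n)) \<longlonglongrightarrow> p" unfolding p_def by (rule X.survival_LIMSEQ[OF X(2)])
  have limY: "(\<lambda>n. survival e ((!) k) (2 * n)) \<longlonglongrightarrow> q" unfolding q_def by (rule Y.survival_LIMSEQ[OF Y(2)])
  define S where "S = (\<Sum>n. v n)"
  have "0 < S" unfolding S_def by (intro suminf_pos sv nn)
  have "0 \<le> p" unfolding p_def by simp
  have "1 \<le> q * S"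
    unfolding S_def by (rule renewal_transient[OF renY limY sv])
  have "p * (S + (u 1 - v 1)) \<le> 1"
  proof (rule LIMSEQ_le_const2)
    show "(\<lambda>n. p * ((\<Sum>j\<le>n. v j) + (u 1 - v 1))) \<longlonglongrightarrow> p * (S + (u 1 - v 1))"
      unfolding S_def by (intro tendsto_intros summable_LIMSEQ' sv)
    have "p * ((\<Sum>j\<le>n. v j) + (u 1 - v 1)) \<le> 1" if "1 \<le> n" for n
    proof -
      have "u 1 - v 1 \<le> (\<Sum>j\<le>n. u j - v j)"
        using that le by (intro member_le_sum[where f = "\<lambda>j. u j - v j"]) (auto simp: u_def v_def)
      then have "p * ((\<Sum>j\<le>n. v j) + (u 1 - v 1)) \<le> p * (\<Sum>j\<le>n. u j)"
        using \<open>0 \<le> p\<close> by (intro mult_left_mono) (auto simp: sum_subtractf)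
      also have "\<dots> \<le> 1" by (rule renewal_limit_le[OF renX limX])
      finally show ?thesis .
    qed
    then show "\<exists>m. \<forall>n\<ge>m. p * ((\<Sum>j\<le>n. v j) + (u 1 - v 1)) \<le> 1" by blast
  qed
  with \<open>1 \<le> q * S\<close> have le_qS: "p * (S + (u 1 - v 1)) \<le> q * S" by simp
  have "p < q"
  proof (rule ccontr)
    assume "\<not> p < q"
    then have "q * S \<le> p * S" using \<open>0 < S\<close> by (intro mult_right_mono) auto
    with le_qS have "p * (u 1 - v 1) \<le> 0" by (simp add: distrib_left)
    moreover have "0 < u 1 - v 1" using less by (simp add: u_def v_def)
    ultimately have "p \<le> 0" by (simp add: mult_le_0_iff)
    with \<open>\<not> p < q\<close> have "q * S \<le> 0" using \<open>0 < S\<close> by (intro mult_nonpos_nonneg) auto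
    with \<open>1 \<le> q * S\<close> show False by simp
  qed
  then show "\<P>(\<omega> in N. return_time Y \<omega> < \<infinity>) < \<P>(\<omega> in M. return_time X \<omega> < \<infinity>)"
    by (simp add: p_def q_def)
qed

lemma return_prob_list_perm:
  assumes "mset h = mset k" "length h = d"
  shows "return_prob d ((!) h) n = return_prob d ((!) k) n"
proof -
  have "type_series {..<d} ((!) l) = prod_mset (image_mset square_exp (mset l))" if "length l = d" for l
  proof -
    have "type_series {..<d} ((!) l) = (\<Prod>i=0..<length (map square_exp l). map square_exp l ! i)"
      using that by (simp add: type_series_def atLeast0LessThan)
    also have "\<dots> = prod_list (map square_exp l)"
      by (rule prod.list_conv_set_nth[symmetric])
    also have "\<dots> = prod_mset (image_mset square_exp (mset l))"
      by (metis mset_map prod_mset_prod_list)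
    finally show ?thesis .
  qed
  moreover have "length k = d" using assms mset_eq_length by metis
  ultimately show ?thesis using assms by (simp add: return_prob_def)
qed

lemma return_prob_strictly_majorizes:
  assumes h: "prob_vector d h" and k: "prob_vector d k" and maj: "strictly_majorizes h k"
  shows "return_prob d ((!) k) n \<le> return_prob d ((!) h) n" "return_prob d ((!) k) 1 < return_prob d ((!) h) 1"
proof -
  have len: "length h = d" "length k = d" using h k by (auto simp: prob_vector_def)
  have len': "length (decreasing h) = d" "length (decreasing k) = d"
    using len by (auto simp: decreasing_def)
  have mset: "mset (decreasing l) = mset l" for l by (simp add: decreasing_def)
  have maj': "majorizes h k" "mset h \<noteq> mset k" using maj by (auto simp: strictly_majorizes_def)
  have y: "decreasing k ! j \<le> decreasing k ! i" if "i \<le> j" "j < d" for i j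
  proof -
    have "sorted (rev (decreasing k))" by (simp add: decreasing_def)
    then show ?thesis using that len' by (simp add: sorted_rev_iff_nth_mono)
  qed
  have x: "0 \<le> decreasing h ! i" if "i < d" for i
  proof -
    have "decreasing h ! i \<in> set h"
      using that len' nth_mem[of i "decreasing h"] by (simp add: decreasing_def)
    then show ?thesis using h by (auto simp: prob_vector_def in_set_conv_nth)
  qed
  have total: "(\<Sum>i<d. decreasing h ! i) = (\<Sum>i<d. decreasing k ! i)"
    using maj'(1) len by (simp add: majorizes_def)
  have part: "(\<Sum>i<n. decreasing k ! i) \<le> (\<Sum>i<n. decreasing h ! i)" if n: "n \<le> d" for n
  proof -
    consider "n = 0" | "n = d" | "n \<in> {1..<d}"
      using n by (cases "n = 0"; cases "n = d") auto
    then show ?thesis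
      using maj'(1) len total by cases (auto simp: majorizes_def)
  qed
  have ne: "\<exists>i<d. decreasing h ! i \<noteq> decreasing k ! i"
  proof (rule ccontr)
    assume "\<not> (\<exists>i<d. decreasing h ! i \<noteq> decreasing k ! i)"
    then have "decreasing h = decreasing k" using len' by (auto intro!: nth_equalityI)
    then show False using maj'(2) mset by metis
  qed
  note major = return_prob_majorize[of d "(!) (decreasing k)" "(!) (decreasing h)", OF y x part total ne]
  show "return_prob d ((!) k) n \<le> return_prob d ((!) h) n" "return_prob d ((!) k) 1 < return_prob d ((!) h) 1"
    using major return_prob_list_perm[OF mset len'(1)] return_prob_list_perm[OF mset len'(2)] by auto
qed

lemma prob_vector_uniform: "1 \<le> d \<Longrightarrow> prob_vector d (uniform_vector d)"
  by (simp add: prob_vector_def uniform_vector_def)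

text \<open>
  The vector \<open>x\<close> pads the shorter uniform vector with zeros, which add no factor to the type series.
\<close>

lemma return_prob_uniform:
  assumes "1 \<le> d" "d < e"
  shows "return_prob e ((!) (uniform_vector e)) n \<le> return_prob d ((!) (uniform_vector d)) n"
    and "return_prob e ((!) (uniform_vector e)) 1 < return_prob d ((!) (uniform_vector d)) 1"
proof -
  define x where "x i = (if i < d then 1 / real d else 0)" for i
  have return_prob_x: "return_prob e x n = return_prob d ((!) (uniform_vector d)) n" for n
  proof -
    have "type_series {..<e} x = type_series {..<d} x"
      unfolding type_series_def using assms by (intro prod.mono_neutral_right) (auto simp: x_def)
    also have "\<dots> = type_series {..<d} ((!) (uniform_vector d))"
      unfolding type_series_def by (intro prod.cong) (auto simp: x_def uniform_vector_def)
    finally show ?thesis by (simp add: return_prob_def)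
  qed
  have sum_x: "(\<Sum>i<n. x i) = real (min n d) / real d" for n
  proof -
    have "(\<Sum>i<n. x i) = (\<Sum>i<min n d. 1 / real d)"
      by (rule sum.mono_neutral_cong_right) (auto simp: x_def)
    then show ?thesis by simp
  qed
  have sum_y: "(\<Sum>i<n. uniform_vector e ! i) = real n / real e" if "n \<le> e" for n
    using that by (simp add: uniform_vector_def)
  have "uniform_vector e ! j \<le> uniform_vector e ! i" if "i \<le> j" "j < e" for i j
    using that by (simp add: uniform_vector_def)
  moreover have "0 \<le> x i" for i by (simp add: x_def)
  moreover have "(\<Sum>i<n. uniform_vector e ! i) \<le> (\<Sum>i<n. x i)" if "n \<le> e" for n
  proof (cases "n \<le> d")
    case True
    then show ?thesis
      unfolding sum_x sum_y[OF that] using assms by (auto simp: min_def intro!: divide_left_mono)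
  next
    case False
    then show ?thesis
      unfolding sum_x sum_y[OF that] using assms that by (simp add: min_def)
  qed
  moreover have "(\<Sum>i<e. x i) = (\<Sum>i<e. uniform_vector e ! i)"
    unfolding sum_x using assms by (simp add: sum_y)
  moreover have "\<exists>i<e. x i \<noteq> uniform_vector e ! i"
    using assms by (intro exI[of _ 0]) (auto simp: x_def uniform_vector_def)
  ultimately show "return_prob e ((!) (uniform_vector e)) n \<le> return_prob d ((!) (uniform_vector d)) n"
    "return_prob e ((!) (uniform_vector e)) 1 < return_prob d ((!) (uniform_vector d)) 1"
    using return_prob_majorize[of e "(!) (uniform_vector e)" x] return_prob_x by auto
qed

theorem mainTheorem3:
  fixes M :: "'a measure" and X :: "nat \<Rightarrow> 'a \<Rightarrow> nat \<Rightarrow> int"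
    and N :: "'b measure" and Y :: "nat \<Rightarrow> 'b \<Rightarrow> nat \<Rightarrow> int"
  shows
    "(\<forall>d h' h''.
        1 \<le> d \<and> prob_vector d h' \<and> prob_vector d h'' \<and> strictly_majorizes h' h'' \<and>
        random_walk d h' M X \<and> random_walk d h'' N Y \<longrightarrow>
          \<P>(\<omega> in M. return_time X \<omega> < \<infinity>) \<ge> \<P>(\<omega> in N. return_time Y \<omega> < \<infinity>) \<and>
          (num_nonzero h'' < 3 \<longrightarrow>
             \<P>(\<omega> in M. return_time X \<omega> < \<infinity>) = 1 \<and> \<P>(\<omega> in N. return_time Y \<omega> < \<infinity>) = 1) \<and>
          (3 \<le> num_nonzero h'' \<longrightarrow>
             expected_returns N Y < \<infinity> \<and> expected_returns M X > expected_returns N Y \<and>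
             \<P>(\<omega> in M. return_time X \<omega> < \<infinity>) > \<P>(\<omega> in N. return_time Y \<omega> < \<infinity>)) \<and>
          \<P>(\<omega> in M. return_time X \<omega> \<le> 2) > \<P>(\<omega> in N. return_time Y \<omega> \<le> 2) \<and>
          strictly_stoch_smaller M (return_time X) N (return_time Y)) \<and>
     (\<forall>d e. 3 \<le> d \<and> d < e \<and>
        random_walk d (uniform_vector d) M X \<and> random_walk e (uniform_vector e) N Y \<longrightarrow>
          \<P>(\<omega> in M. return_time X \<omega> < \<infinity>) > \<P>(\<omega> in N. return_time Y \<omega> < \<infinity>)) \<and>
     (\<forall>d. 1 \<le> d \<and>
        random_walk d (uniform_vector d) M X \<and>
        random_walk (Suc d) (uniform_vector (Suc d)) N Y \<longrightarrow>
          strictly_stoch_smaller M (return_time X) N (return_time Y))"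
proof (intro conjI allI impI; elim conjE)
  fix d h' h''
  assume h: "prob_vector d h'" "prob_vector d h''" "strictly_majorizes h' h''"
    and walks: "random_walk d h' M X" "random_walk d h'' N Y"
  note return_prob = return_prob_strictly_majorizes[OF h]
  note order = strict_stoch_order[OF walks(1) h(1) walks(2) h(2) return_prob]
  show a: "\<P>(\<omega> in M. return_time X \<omega> < \<infinity>) \<ge> \<P>(\<omega> in N. return_time Y \<omega> < \<infinity>)"
    by (rule order(1))
  show "\<P>(\<omega> in M. return_time X \<omega> \<le> 2) > \<P>(\<omega> in N. return_time Y \<omega> \<le> 2)"
    by (rule order(2))
  show "strictly_stoch_smaller M (return_time X) N (return_time Y)"
    by (rule order(3))
  {
    assume "num_nonzero h'' < 3"
    then show b: "\<P>(\<omega> in N. return_time Y \<omega> < \<infinity>) = 1"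
      by (rule random_walk.recurrent[OF walks(2) h(2)])
    interpret X: random_walk d h' M X by (rule walks(1))
    show "\<P>(\<omega> in M. return_time X \<omega> < \<infinity>) = 1"
      by (rule antisym[OF X.prob_le_1]) (use a b in simp)
  }
  {
    assume many: "3 \<le> num_nonzero h''"
    note strict = transient_strict[OF walks(1) h(1) walks(2) h(2) return_prob many]
    show "expected_returns N Y < \<infinity>" by (rule strict(1))
    show "expected_returns M X > expected_returns N Y" by (rule strict(2))
    show "\<P>(\<omega> in M. return_time X \<omega> < \<infinity>) > \<P>(\<omega> in N. return_time Y \<omega> < \<infinity>)"
      by (rule strict(3))
  }
next
  fix d e :: nat
  assume d: "3 \<le> d" "d < e"
    and walks: "random_walk d (uniform_vector d) M X" "random_walk e (uniform_vector e) N Y"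
  have "{i. i < e \<and> uniform_vector e ! i \<noteq> 0} = {..<e}"
    using d by (auto simp: uniform_vector_def)
  then have "3 \<le> num_nonzero (uniform_vector e)"
    using d by (simp add: num_nonzero_def uniform_vector_def)
  then show "\<P>(\<omega> in M. return_time X \<omega> < \<infinity>) > \<P>(\<omega> in N. return_time Y \<omega> < \<infinity>)"
    using d by (intro transient_strict(3)[OF walks(1) _ walks(2) _ return_prob_uniform] prob_vector_uniform) auto
next
  fix d :: nat
  assume d: "1 \<le> d"
    and walks: "random_walk d (uniform_vector d) M X" "random_walk (Suc d) (uniform_vector (Suc d)) N Y"
  show "strictly_stoch_smaller M (return_time X) N (return_time Y)"
    using d by (intro strict_stoch_order(3)[OF walks(1) _ walks(2) _ return_prob_uniform] prob_vector_uniform) auto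
qed

end
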